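(* Let $X_\tau$ be a site with a final object $X$, $A$ an abelian sheaf on $X_\tau$, $G$ a finite group, and $\mathscr Y$ an abelian gerbe over $X$ banded by $A$. Let $(F,\alpha)$ be the data of an action $\{F_g\}_{g\in G}$ of $G$ on $\mathscr Y$ together with connecting $2$-morphisms $\{\alpha_{g,h}\}_{g,h\in G}$. Then $\kappa_{(F,\alpha)}$ is a $3$-cocycle with values in $A(X)$ (for the underlying action of $G$) whose cohomology class in $H^3(G,A(X))$ is independent of the connecting $2$-morphisms $\{\alpha_{g,h}\}_{g,h\in G}$.
   Context: An abelian gerbe over $X$ is a stack in groupoids over $X_\tau$ in which objects exist locally over every $U$, any two objects over the same $U$ are locally isomorphic, and all automorphism sheaves are abelian. It is banded by $A$ if it is given with isomorphisms $A|_U\cong\mathrm{Aut}(x)$ for all objects $x$ over $U$, compatible with isomorphisms of objects and with restriction. A morphism of gerbes is a morphism of fibered categories over $X_\tau$; it induces a homomorphism of bands. $2$-morphisms are base-preserving natural transformations. For a morphism $F$ into a gerbe banded by $A$, the group of $2$-automorphisms of $F$ is identified with $A(X)$ (a section acts on each $F(x)$ through $A|_U\cong\mathrm{Aut}(F(x))$). An action of $G$ on $\mathscr Y$ is a family of morphisms $F_g:\mathscr Y\to\mathscr Y$ such that $F_1$ induces the identity on $A$ and $F_{gh}$ is $2$-isomorphic to $F_g\circ F_h$ for all $g,h$. The maps induced by the $F_g$ on the band define the underlying left action of $G$ on $A$. Connecting $2$-morphisms are a choice of $2$-morphisms $\alpha_{g,h}:F_{gh}\to F_g\circ F_h$. The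 $3$-cochain $\kappa_{(F,\alpha)}$ is defined by letting $\kappa_{(F,\alpha)}(g_1,g_2,g_3)\in A(X)$ be the $2$-automorphism of $F_{g_1g_2g_3}$ with $$(\alpha_{g_1,g_2}\star \mathrm{id}_{F_{g_3}})\circ\alpha_{g_1g_2,g_3}\circ\kappa_{(F,\alpha)}(g_1,g_2,g_3)=(\mathrm{id}_{F_{g_1}}\star\alpha_{g_2,g_3})\circ\alpha_{g_1,g_2g_3}.$$ *)

theory Defs
  imports "HOL-Algebra.Coset" "HOL-Algebra.FiniteProduct"
begin

section \<open>Categories and functors\<close>

record ('o, 'm) category =
  Obj :: "'o set"
  Arr :: "'m set"
  Src :: "'m \<Rightarrow> 'o"
  Tgt :: "'m \<Rightarrow> 'o"
  Ide :: "'o \<Rightarrow> 'm"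
  Cmp :: "'m \<Rightarrow> 'm \<Rightarrow> 'm" (infixl "\<cdot>\<index>" 75)

definition Hom :: "('o, 'm) category \<Rightarrow> 'o \<Rightarrow> 'o \<Rightarrow> 'm set" where
  "Hom C a b = {f \<in> Arr C. Src C f = a \<and> Tgt C f = b}"

locale category =
  fixes C :: "('o, 'm) category" (structure)
  assumes Src_Obj: "f \<in> Arr C \<Longrightarrow> Src C f \<in> Obj C"
    and Tgt_Obj: "f \<in> Arr C \<Longrightarrow> Tgt C f \<in> Obj C"
    and Ide_Hom: "a \<in> Obj C \<Longrightarrow> Ide C a \<in> Hom C a a"
    and Cmp_Hom: "\<lbrakk>g \<in> Hom C b c; f \<in> Hom C a b\<rbrakk> \<Longrightarrow> g \<cdot> f \<in> Hom C a c"
    and Ide_left: "f \<in> Hom C a b \<Longrightarrow> Ide C b \<cdot> f = f"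
    and Ide_right: "f \<in> Hom C a b \<Longrightarrow> f \<cdot> Ide C a = f"
    and Cmp_assoc:
      "\<lbrakk>h \<in> Hom C c d; g \<in> Hom C b c; f \<in> Hom C a b\<rbrakk> \<Longrightarrow> (h \<cdot> g) \<cdot> f = h \<cdot> (g \<cdot> f)"

definition is_iso :: "('o, 'm) category \<Rightarrow> 'm \<Rightarrow> bool" where
  "is_iso C f \<longleftrightarrow> f \<in> Arr C \<and>
     (\<exists>g \<in> Hom C (Tgt C f) (Src C f).
        g \<cdot>\<^bsub>C\<^esub> f = Ide C (Src C f) \<and> f \<cdot>\<^bsub>C\<^esub> g = Ide C (Tgt C f))"

definition final_object :: "('o, 'm) category \<Rightarrow> 'o \<Rightarrow> bool" where
  "final_object C X \<longleftrightarrow> X \<in> Obj C \<and> (\<forall>U \<in> Obj C. \<exists>!f. f \<in> Hom C U X)"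

definition to_final :: "('o, 'm) category \<Rightarrow> 'o \<Rightarrow> 'o \<Rightarrow> 'm" where
  "to_final C X U = (THE f. f \<in> Hom C U X)"

record ('o1, 'm1, 'o2, 'm2) functor_data =
  FObj :: "'o1 \<Rightarrow> 'o2"
  FArr :: "'m1 \<Rightarrow> 'm2"

definition is_functor ::
    "('o1, 'm1) category \<Rightarrow> ('o2, 'm2) category \<Rightarrow> ('o1, 'm1, 'o2, 'm2) functor_data \<Rightarrow> bool" where
  "is_functor C D F \<longleftrightarrow>
     (\<forall>a \<in> Obj C. FObj F a \<in> Obj D) \<and>
     (\<forall>a b. \<forall>f \<in> Hom C a b. FArr F f \<in> Hom D (FObj F a) (FObj F b)) \<and>
     (\<forall>a \<in> Obj C. FArr F (Ide C a) = Ide D (FObj F a)) \<and>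
     (\<forall>a b c. \<forall>f \<in> Hom C a b. \<forall>g \<in> Hom C b c.
        FArr F (g \<cdot>\<^bsub>C\<^esub> f) = FArr F g \<cdot>\<^bsub>D\<^esub> FArr F f)"

definition func_comp ::
    "('o2, 'm2, 'o3, 'm3) functor_data \<Rightarrow> ('o1, 'm1, 'o2, 'm2) functor_data
      \<Rightarrow> ('o1, 'm1, 'o3, 'm3) functor_data" where
  "func_comp F H = \<lparr>FObj = FObj F \<circ> FObj H, FArr = FArr F \<circ> FArr H\<rparr>"


section \<open>Sites and abelian sheaves\<close>

definition is_sieve :: "('o, 'm) category \<Rightarrow> 'o \<Rightarrow> 'm set \<Rightarrow> bool" where
  "is_sieve C U S \<longleftrightarrow> S \<subseteq> {f \<in> Arr C. Tgt C f = U} \<and>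
     (\<forall>f \<in> S. \<forall>g \<in> Arr C. Tgt C g = Src C f \<longrightarrow> f \<cdot>\<^bsub>C\<^esub> g \<in> S)"

definition pull_sieve :: "('o, 'm) category \<Rightarrow> 'm \<Rightarrow> 'm set \<Rightarrow> 'm set" where
  "pull_sieve C f S = {g \<in> Arr C. Tgt C g = Src C f \<and> f \<cdot>\<^bsub>C\<^esub> g \<in> S}"

text \<open>The topology is given by its covering sieves; \<open>J U\<close> is the set of covering sieves of
  \<open>U\<close>. A pretopology given by covering families enters through the sieves that contain a sieve
  generated by such a family; it has the same sheaves and stacks.\<close>

locale site = category C for C :: "('o, 'm) category" (structure) +
  fixes J :: "'o \<Rightarrow> 'm set set"
  assumes cover_sieve: "\<lbrakk>U \<in> Obj C; S \<in> J U\<rbrakk> \<Longrightarrow> is_sieve C U S"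
    and cover_max: "U \<in> Obj C \<Longrightarrow> {f \<in> Arr C. Tgt C f = U} \<in> J U"
    and cover_pull: "\<lbrakk>f \<in> Hom C V U; S \<in> J U\<rbrakk> \<Longrightarrow> pull_sieve C f S \<in> J V"
    and cover_local:
      "\<lbrakk>U \<in> Obj C; S \<in> J U; is_sieve C U R; \<And>f. f \<in> S \<Longrightarrow> pull_sieve C f R \<in> J (Src C f)\<rbrakk>
        \<Longrightarrow> R \<in> J U"

text \<open>Groups of sections are written multiplicatively.\<close>

record ('o, 'm, 'a) presheaf =
  Sec :: "'o \<Rightarrow> 'a monoid"
  Res :: "'m \<Rightarrow> 'a \<Rightarrow> 'a"

locale abelian_presheaf = category C for C :: "('o, 'm) category" (structure) +
  fixes A :: "('o, 'm, 'a) presheaf"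
  assumes Sec_comm_group: "U \<in> Obj C \<Longrightarrow> comm_group (Sec A U)"
    and Res_hom: "f \<in> Hom C V U \<Longrightarrow> Res A f \<in> hom (Sec A U) (Sec A V)"
    and Res_Ide: "\<lbrakk>U \<in> Obj C; s \<in> carrier (Sec A U)\<rbrakk> \<Longrightarrow> Res A (Ide C U) s = s"
    and Res_Cmp: "\<lbrakk>f \<in> Hom C V U; g \<in> Hom C W V; s \<in> carrier (Sec A U)\<rbrakk>
        \<Longrightarrow> Res A (f \<cdot> g) s = Res A g (Res A f s)"

definition matching_family ::
    "('o, 'm) category \<Rightarrow> ('o, 'm, 'a) presheaf \<Rightarrow> 'm set \<Rightarrow> ('m \<Rightarrow> 'a) \<Rightarrow> bool" where
  "matching_family C A S s \<longleftrightarrow>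
     (\<forall>f \<in> S. s f \<in> carrier (Sec A (Src C f)) \<and>
        (\<forall>g \<in> Arr C. Tgt C g = Src C f \<longrightarrow> Res A g (s f) = s (f \<cdot>\<^bsub>C\<^esub> g)))"

locale abelian_sheaf = site C J + abelian_presheaf C A
  for C :: "('o, 'm) category" (structure) and J and A :: "('o, 'm, 'a) presheaf" +
  assumes glue: "\<lbrakk>U \<in> Obj C; S \<in> J U; matching_family C A S s\<rbrakk>
        \<Longrightarrow> \<exists>!t. t \<in> carrier (Sec A U) \<and> (\<forall>f \<in> S. Res A f t = s f)"

definition sheaf_endo ::
    "('o, 'm) category \<Rightarrow> ('o, 'm, 'a) presheaf \<Rightarrow> ('o \<Rightarrow> 'a \<Rightarrow> 'a) \<Rightarrow> bool" where
  "sheaf_endo C A \<phi> \<longleftrightarrow>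
     (\<forall>U \<in> Obj C. \<phi> U \<in> hom (Sec A U) (Sec A U)) \<and>
     (\<forall>U V. \<forall>f \<in> Hom C V U. \<forall>s \<in> carrier (Sec A U). \<phi> V (Res A f s) = Res A f (\<phi> U s))"


section \<open>Stacks in groupoids\<close>

definition HomOver ::
    "('p, 'q) category \<Rightarrow> ('p, 'q, 'o, 'm) functor_data \<Rightarrow> 'm \<Rightarrow> 'p \<Rightarrow> 'p \<Rightarrow> 'q set" where
  "HomOver Y P f x y = {\<phi> \<in> Hom Y x y. FArr P \<phi> = f}"

locale fibered_in_groupoids = C: category C + Y: category Y
  for C :: "('o, 'm) category" and Y :: "('p, 'q) category" +
  fixes P :: "('p, 'q, 'o, 'm) functor_data"
  assumes proj: "is_functor Y C P"
    and pullback_ex: "\<lbrakk>y \<in> Obj Y; f \<in> Hom C V (FObj P y)\<rbrakk>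
        \<Longrightarrow> \<exists>x \<in> Obj Y. \<exists>\<phi>. \<phi> \<in> HomOver Y P f x y"
    and cartesian: "\<lbrakk>\<phi> \<in> Hom Y y x; \<psi> \<in> Hom Y z x; h \<in> Hom C (FObj P z) (FObj P y);
        FArr P \<phi> \<cdot>\<^bsub>C\<^esub> h = FArr P \<psi>\<rbrakk>
        \<Longrightarrow> \<exists>!\<chi>. \<chi> \<in> HomOver Y P h z y \<and> \<phi> \<cdot>\<^bsub>Y\<^esub> \<chi> = \<psi>"

text \<open>A section over \<open>f : V \<rightarrow> U\<close> of the presheaf \<open>Hom(x, y)\<close> on \<open>C/U\<close> is an arrow over the
  identity of \<open>V\<close> between pullbacks of \<open>x\<close> and \<open>y\<close> along \<open>f\<close>. To avoid choosing pullbacks, it is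
  given here, for every pullback \<open>\<phi> : x' \<rightarrow> x\<close> over \<open>f\<close>, as the composite \<open>m \<phi> : x' \<rightarrow> y\<close> over
  \<open>f\<close>. Compatibility with restriction is \<open>m (\<phi> \<cdot> \<chi>) = m \<phi> \<cdot> \<chi>\<close>; for \<open>\<chi>\<close> over an identity it also
  expresses independence of the pullback.\<close>

definition local_hom ::
    "('p, 'q) category \<Rightarrow> ('p, 'q, 'o, 'm) functor_data \<Rightarrow> 'm set \<Rightarrow> 'p \<Rightarrow> 'p \<Rightarrow> ('q \<Rightarrow> 'q) \<Rightarrow> bool"
  where
  "local_hom Y P S x y m \<longleftrightarrow>
     (\<forall>z. \<forall>\<phi> \<in> Hom Y z x. FArr P \<phi> \<in> S \<longrightarrow>
        m \<phi> \<in> HomOver Y P (FArr P \<phi>) z y \<and>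
        (\<forall>w. \<forall>\<chi> \<in> Hom Y w z. m (\<phi> \<cdot>\<^bsub>Y\<^esub> \<chi>) = m \<phi> \<cdot>\<^bsub>Y\<^esub> \<chi>))"

text \<open>A descent datum on the sieve \<open>S\<close> is a functor over \<open>C\<close> from \<open>S\<close>, viewed as a full
  subcategory of \<open>C/U\<close>, to the fibered category: \<open>d f\<close> is the value at \<open>f\<close>, and \<open>e f g\<close> is the value
  at the arrow \<open>g : f \<cdot> g \<rightarrow> f\<close>.\<close>

definition descent_datum ::
    "('o, 'm) category \<Rightarrow> ('p, 'q) category \<Rightarrow> ('p, 'q, 'o, 'm) functor_data \<Rightarrow> 'm set
      \<Rightarrow> ('m \<Rightarrow> 'p) \<Rightarrow> ('m \<Rightarrow> 'm \<Rightarrow> 'q) \<Rightarrow> bool" where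
  "descent_datum C Y P S d e \<longleftrightarrow>
     (\<forall>f \<in> S. d f \<in> Obj Y \<and> FObj P (d f) = Src C f \<and> e f (Ide C (Src C f)) = Ide Y (d f)) \<and>
     (\<forall>f \<in> S. \<forall>g \<in> Arr C. Tgt C g = Src C f \<longrightarrow>
        e f g \<in> HomOver Y P g (d (f \<cdot>\<^bsub>C\<^esub> g)) (d f) \<and>
        (\<forall>h \<in> Arr C. Tgt C h = Src C g \<longrightarrow>
           e f (g \<cdot>\<^bsub>C\<^esub> h) = e f g \<cdot>\<^bsub>Y\<^esub> e (f \<cdot>\<^bsub>C\<^esub> g) h))"

definition effective_descent ::
    "('o, 'm) category \<Rightarrow> ('p, 'q) category \<Rightarrow> ('p, 'q, 'o, 'm) functor_data \<Rightarrow> 'o \<Rightarrow> 'm set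
      \<Rightarrow> ('m \<Rightarrow> 'p) \<Rightarrow> ('m \<Rightarrow> 'm \<Rightarrow> 'q) \<Rightarrow> bool" where
  "effective_descent C Y P U S d e \<longleftrightarrow>
     (\<exists>x \<in> Obj Y. FObj P x = U \<and>
       (\<exists>\<phi>. \<forall>f \<in> S. \<phi> f \<in> HomOver Y P f (d f) x \<and>
          (\<forall>g \<in> Arr C. Tgt C g = Src C f \<longrightarrow> \<phi> f \<cdot>\<^bsub>Y\<^esub> e f g = \<phi> (f \<cdot>\<^bsub>C\<^esub> g))))"

locale stack_in_groupoids = site C J + fibered_in_groupoids C Y P
  for C :: "('o, 'm) category" and J and Y :: "('p, 'q) category"
    and P :: "('p, 'q, 'o, 'm) functor_data" +
  assumes hom_sheaf:
      "\<lbrakk>x \<in> Obj Y; y \<in> Obj Y; FObj P x = FObj P y; S \<in> J (FObj P x); local_hom Y P S x y m\<rbrakk>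
        \<Longrightarrow> \<exists>!\<mu>. \<mu> \<in> HomOver Y P (Ide C (FObj P x)) x y \<and>
              (\<forall>z. \<forall>\<phi> \<in> Hom Y z x. FArr P \<phi> \<in> S \<longrightarrow> \<mu> \<cdot>\<^bsub>Y\<^esub> \<phi> = m \<phi>)"
    and descent: "\<lbrakk>U \<in> Obj C; S \<in> J U; descent_datum C Y P S d e\<rbrakk>
        \<Longrightarrow> effective_descent C Y P U S d e"


section \<open>Banded abelian gerbes\<close>

definition aut_group ::
    "('o, 'm) category \<Rightarrow> ('p, 'q) category \<Rightarrow> ('p, 'q, 'o, 'm) functor_data \<Rightarrow> 'p \<Rightarrow> 'q monoid"
  where
  "aut_group C Y P x =
     \<lparr>carrier = {\<sigma> \<in> HomOver Y P (Ide C (FObj P x)) x x. is_iso Y \<sigma>},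
      mult = Cmp Y, one = Ide Y x\<rparr>"

text \<open>The sections of the automorphism sheaf of \<open>x\<close> over \<open>f : V \<rightarrow> U\<close> form the automorphism
  group of a pullback of \<open>x\<close> along \<open>f\<close>, so all automorphism sheaves are abelian iff the
  automorphism groups of all objects are.\<close>

locale abelian_gerbe = stack_in_groupoids C J Y P
  for C :: "('o, 'm) category" and J and Y :: "('p, 'q) category"
    and P :: "('p, 'q, 'o, 'm) functor_data" +
  assumes locally_nonempty:
      "U \<in> Obj C \<Longrightarrow> \<exists>S \<in> J U. \<forall>f \<in> S. \<exists>x \<in> Obj Y. FObj P x = Src C f"
    and locally_isomorphic:
      "\<lbrakk>x \<in> Obj Y; y \<in> Obj Y; FObj P x = FObj P y\<rbrakk>
        \<Longrightarrow> \<exists>S \<in> J (FObj P x). \<forall>f \<in> S.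
              \<exists>x' y' \<phi> \<psi> \<sigma>. \<phi> \<in> HomOver Y P f x' x \<and> \<psi> \<in> HomOver Y P f y' y \<and>
                \<sigma> \<in> HomOver Y P (Ide C (Src C f)) x' y' \<and> is_iso Y \<sigma>"
    and abelian: "x \<in> Obj Y \<Longrightarrow> comm_group (aut_group C Y P x)"

text \<open>By compatibility with restriction, the sheaf isomorphism from \<open>A|U\<close> to the automorphism
  sheaf of \<open>x\<close> is given over \<open>f : V \<rightarrow> U\<close> by the isomorphism from \<open>A(V)\<close> to the automorphism group
  of a pullback of \<open>x\<close>. A band is therefore a family of isomorphisms \<open>b x\<close> from \<open>A(U)\<close> to the
  automorphism group of \<open>x\<close>, \<open>x\<close> over \<open>U\<close>. For \<open>\<phi>\<close> over an identity, naturality is compatibility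
  with isomorphisms of objects; for general \<open>\<phi>\<close> it includes compatibility with restriction.\<close>

locale banded_gerbe = abelian_sheaf C J A + abelian_gerbe C J Y P
  for C :: "('o, 'm) category" and J and A :: "('o, 'm, 'a) presheaf"
    and Y :: "('p, 'q) category" and P :: "('p, 'q, 'o, 'm) functor_data" +
  fixes b :: "'p \<Rightarrow> 'a \<Rightarrow> 'q"
  assumes band_iso: "x \<in> Obj Y \<Longrightarrow> b x \<in> iso (Sec A (FObj P x)) (aut_group C Y P x)"
    and band_natural: "\<lbrakk>\<phi> \<in> Hom Y y x; s \<in> carrier (Sec A (FObj P x))\<rbrakk>
        \<Longrightarrow> \<phi> \<cdot>\<^bsub>Y\<^esub> b y (Res A (FArr P \<phi>) s) = b x s \<cdot>\<^bsub>Y\<^esub> \<phi>"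

type_synonym ('p, 'q) endo = "('p, 'q, 'p, 'q) functor_data"

definition gerbe_endo ::
    "('p, 'q) category \<Rightarrow> ('p, 'q, 'o, 'm) functor_data \<Rightarrow> ('p, 'q) endo \<Rightarrow> bool" where
  "gerbe_endo Y P F \<longleftrightarrow> is_functor Y Y F \<and>
     (\<forall>x \<in> Obj Y. FObj P (FObj F x) = FObj P x) \<and>
     (\<forall>\<phi> \<in> Arr Y. FArr P (FArr F \<phi>) = FArr P \<phi>)"

definition induces_on_band ::
    "('o, 'm) category \<Rightarrow> ('o, 'm, 'a) presheaf \<Rightarrow> ('p, 'q) category
      \<Rightarrow> ('p, 'q, 'o, 'm) functor_data \<Rightarrow> ('p \<Rightarrow> 'a \<Rightarrow> 'q) \<Rightarrow> ('p, 'q) endo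
      \<Rightarrow> ('o \<Rightarrow> 'a \<Rightarrow> 'a) \<Rightarrow> bool" where
  "induces_on_band C A Y P b F \<phi> \<longleftrightarrow> sheaf_endo C A \<phi> \<and>
     (\<forall>x \<in> Obj Y. \<forall>s \<in> carrier (Sec A (FObj P x)).
        FArr F (b x s) = b (FObj F x) (\<phi> (FObj P x) s))"

text \<open>The restriction to carriers only serves to make the function unique.\<close>

definition band_map ::
    "('o, 'm) category \<Rightarrow> ('o, 'm, 'a) presheaf \<Rightarrow> ('p, 'q) category
      \<Rightarrow> ('p, 'q, 'o, 'm) functor_data \<Rightarrow> ('p \<Rightarrow> 'a \<Rightarrow> 'q) \<Rightarrow> ('p, 'q) endo
      \<Rightarrow> 'o \<Rightarrow> 'a \<Rightarrow> 'a" where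
  "band_map C A Y P b F =
     (THE \<phi>. induces_on_band C A Y P b F \<phi> \<and>
        \<phi> \<in> (\<Pi>\<^sub>E U \<in> Obj C. carrier (Sec A U) \<rightarrow>\<^sub>E carrier (Sec A U)))"


section \<open>2-morphisms\<close>

definition two_morphism ::
    "('o, 'm) category \<Rightarrow> ('p, 'q) category \<Rightarrow> ('p, 'q, 'o, 'm) functor_data
      \<Rightarrow> ('p, 'q) endo \<Rightarrow> ('p, 'q) endo \<Rightarrow> ('p \<Rightarrow> 'q) \<Rightarrow> bool" where
  "two_morphism C Y P F F' \<eta> \<longleftrightarrow>
     (\<forall>x \<in> Obj Y. \<eta> x \<in> HomOver Y P (Ide C (FObj P x)) (FObj F x) (FObj F' x)) \<and>
     (\<forall>x y. \<forall>\<phi> \<in> Hom Y x y. \<eta> y \<cdot>\<^bsub>Y\<^esub> FArr F \<phi> = FArr F' \<phi> \<cdot>\<^bsub>Y\<^esub> \<eta> x)"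

definition two_isomorphic ::
    "('o, 'm) category \<Rightarrow> ('p, 'q) category \<Rightarrow> ('p, 'q, 'o, 'm) functor_data
      \<Rightarrow> ('p, 'q) endo \<Rightarrow> ('p, 'q) endo \<Rightarrow> bool" where
  "two_isomorphic C Y P F F' \<longleftrightarrow>
     (\<exists>\<eta>. two_morphism C Y P F F' \<eta> \<and> (\<forall>x \<in> Obj Y. is_iso Y (\<eta> x)))"

definition vcomp :: "('p, 'q) category \<Rightarrow> ('p \<Rightarrow> 'q) \<Rightarrow> ('p \<Rightarrow> 'q) \<Rightarrow> 'p \<Rightarrow> 'q" where
  "vcomp Y \<theta> \<eta> = (\<lambda>x. \<theta> x \<cdot>\<^bsub>Y\<^esub> \<eta> x)"

text \<open>\<open>whisker_right \<eta> F\<close> is \<open>\<eta> \<star> id\<^sub>F\<close>, and \<open>whisker_left F \<eta>\<close> is \<open>id\<^sub>F \<star> \<eta>\<close>.\<close>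

definition whisker_right :: "('p \<Rightarrow> 'q) \<Rightarrow> ('p, 'q) endo \<Rightarrow> 'p \<Rightarrow> 'q" where
  "whisker_right \<eta> F = (\<lambda>x. \<eta> (FObj F x))"

definition whisker_left :: "('p, 'q) endo \<Rightarrow> ('p \<Rightarrow> 'q) \<Rightarrow> 'p \<Rightarrow> 'q" where
  "whisker_left F \<eta> = (\<lambda>x. FArr F (\<eta> x))"

text \<open>The 2-automorphism of \<open>F\<close> given by a global section \<open>s\<close> of the band.\<close>

definition section_aut ::
    "('o, 'm) category \<Rightarrow> 'o \<Rightarrow> ('o, 'm, 'a) presheaf \<Rightarrow> ('p, 'q, 'o, 'm) functor_data
      \<Rightarrow> ('p \<Rightarrow> 'a \<Rightarrow> 'q) \<Rightarrow> ('p, 'q) endo \<Rightarrow> 'a \<Rightarrow> 'p \<Rightarrow> 'q" where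
  "section_aut C X A P b F s = (\<lambda>x. b (FObj F x) (Res A (to_final C X (FObj P x)) s))"


section \<open>Group cohomology\<close>

definition is_G_module ::
    "'g monoid \<Rightarrow> 'a monoid \<Rightarrow> ('g \<Rightarrow> 'a \<Rightarrow> 'a) \<Rightarrow> bool" where
  "is_G_module G M act \<longleftrightarrow> comm_group M \<and>
     (\<forall>g \<in> carrier G. act g \<in> hom M M) \<and>
     (\<forall>m \<in> carrier M. act \<one>\<^bsub>G\<^esub> m = m) \<and>
     (\<forall>g \<in> carrier G. \<forall>h \<in> carrier G. \<forall>m \<in> carrier M. act (g \<otimes>\<^bsub>G\<^esub> h) m = act g (act h m))"

definition tuples :: "'g monoid \<Rightarrow> nat \<Rightarrow> 'g list set" where
  "tuples G n = {gs. length gs = n \<and> set gs \<subseteq> carrier G}"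

definition cochain_group :: "'g monoid \<Rightarrow> 'a monoid \<Rightarrow> nat \<Rightarrow> ('g list \<Rightarrow> 'a) monoid" where
  "cochain_group G M n =
     \<lparr>carrier = tuples G n \<rightarrow>\<^sub>E carrier M,
      mult = (\<lambda>c d. \<lambda>gs \<in> tuples G n. c gs \<otimes>\<^bsub>M\<^esub> d gs),
      one = (\<lambda>gs \<in> tuples G n. \<one>\<^bsub>M\<^esub>)\<rparr>"

definition merge :: "'g monoid \<Rightarrow> nat \<Rightarrow> 'g list \<Rightarrow> 'g list" where
  "merge G i gs = take i gs @ [gs ! i \<otimes>\<^bsub>G\<^esub> gs ! Suc i] @ drop (i + 2) gs"

text \<open>The inhomogeneous differential from \<open>n\<close>-cochains to \<open>(n+1)\<close>-cochains, written
  multiplicatively. Indices are zero-based, so \<open>merge G i\<close> multiplies the entries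
  usually numbered \<open>i + 1\<close> and \<open>i + 2\<close>, and its term has sign \<open>(-1) ^ (i + 1)\<close>.\<close>

definition differential ::
    "'g monoid \<Rightarrow> 'a monoid \<Rightarrow> ('g \<Rightarrow> 'a \<Rightarrow> 'a) \<Rightarrow> nat \<Rightarrow> ('g list \<Rightarrow> 'a) \<Rightarrow> 'g list \<Rightarrow> 'a" where
  "differential G M act n c = (\<lambda>gs \<in> tuples G (Suc n).
     act (hd gs) (c (tl gs))
     \<otimes>\<^bsub>M\<^esub> (\<Otimes>\<^bsub>M\<^esub>i\<in>{..<n}. c (merge G i gs) [^]\<^bsub>M\<^esub> ((-1) ^ Suc i :: int))
     \<otimes>\<^bsub>M\<^esub> c (butlast gs) [^]\<^bsub>M\<^esub> ((-1) ^ Suc n :: int))"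

definition cocycles ::
    "'g monoid \<Rightarrow> 'a monoid \<Rightarrow> ('g \<Rightarrow> 'a \<Rightarrow> 'a) \<Rightarrow> nat \<Rightarrow> ('g list \<Rightarrow> 'a) set" where
  "cocycles G M act n = {c \<in> carrier (cochain_group G M n).
     differential G M act n c = \<one>\<^bsub>cochain_group G M (Suc n)\<^esub>}"

fun coboundaries ::
    "'g monoid \<Rightarrow> 'a monoid \<Rightarrow> ('g \<Rightarrow> 'a \<Rightarrow> 'a) \<Rightarrow> nat \<Rightarrow> ('g list \<Rightarrow> 'a) set" where
  "coboundaries G M act 0 = {\<one>\<^bsub>cochain_group G M 0\<^esub>}"
| "coboundaries G M act (Suc n) = differential G M act n ` carrier (cochain_group G M n)"

definition cocycle_group ::
    "'g monoid \<Rightarrow> 'a monoid \<Rightarrow> ('g \<Rightarrow> 'a \<Rightarrow> 'a) \<Rightarrow> nat \<Rightarrow> ('g list \<Rightarrow> 'a) monoid" where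
  "cocycle_group G M act n = (cochain_group G M n)\<lparr>carrier := cocycles G M act n\<rparr>"

definition cohomology ::
    "'g monoid \<Rightarrow> 'a monoid \<Rightarrow> ('g \<Rightarrow> 'a \<Rightarrow> 'a) \<Rightarrow> nat \<Rightarrow> ('g list \<Rightarrow> 'a) set monoid" where
  "cohomology G M act n = cocycle_group G M act n Mod coboundaries G M act n"

definition cohomology_class ::
    "'g monoid \<Rightarrow> 'a monoid \<Rightarrow> ('g \<Rightarrow> 'a \<Rightarrow> 'a) \<Rightarrow> nat \<Rightarrow> ('g list \<Rightarrow> 'a) \<Rightarrow> ('g list \<Rightarrow> 'a) set" where
  "cohomology_class G M act n c = coboundaries G M act n #>\<^bsub>cocycle_group G M act n\<^esub> c"


section \<open>Group actions on gerbes\<close>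

definition gerbe_action ::
    "('o, 'm) category \<Rightarrow> ('o, 'm, 'a) presheaf \<Rightarrow> ('p, 'q) category
      \<Rightarrow> ('p, 'q, 'o, 'm) functor_data \<Rightarrow> ('p \<Rightarrow> 'a \<Rightarrow> 'q) \<Rightarrow> 'g monoid
      \<Rightarrow> ('g \<Rightarrow> ('p, 'q) endo) \<Rightarrow> bool" where
  "gerbe_action C A Y P b G F \<longleftrightarrow>
     (\<forall>g \<in> carrier G. gerbe_endo Y P (F g)) \<and>
     (\<forall>U \<in> Obj C. \<forall>s \<in> carrier (Sec A U). band_map C A Y P b (F \<one>\<^bsub>G\<^esub>) U s = s) \<and>
     (\<forall>g \<in> carrier G. \<forall>h \<in> carrier G.
        two_isomorphic C Y P (F (g \<otimes>\<^bsub>G\<^esub> h)) (func_comp (F g) (F h)))"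

definition underlying_action ::
    "('o, 'm) category \<Rightarrow> 'o \<Rightarrow> ('o, 'm, 'a) presheaf \<Rightarrow> ('p, 'q) category
      \<Rightarrow> ('p, 'q, 'o, 'm) functor_data \<Rightarrow> ('p \<Rightarrow> 'a \<Rightarrow> 'q) \<Rightarrow> ('g \<Rightarrow> ('p, 'q) endo)
      \<Rightarrow> 'g \<Rightarrow> 'a \<Rightarrow> 'a" where
  "underlying_action C X A Y P b F g = band_map C A Y P b (F g) X"

definition connecting ::
    "('o, 'm) category \<Rightarrow> ('p, 'q) category \<Rightarrow> ('p, 'q, 'o, 'm) functor_data \<Rightarrow> 'g monoid
      \<Rightarrow> ('g \<Rightarrow> ('p, 'q) endo) \<Rightarrow> ('g \<Rightarrow> 'g \<Rightarrow> 'p \<Rightarrow> 'q) \<Rightarrow> bool" where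
  "connecting C Y P G F \<alpha> \<longleftrightarrow>
     (\<forall>g \<in> carrier G. \<forall>h \<in> carrier G.
        two_morphism C Y P (F (g \<otimes>\<^bsub>G\<^esub> h)) (func_comp (F g) (F h)) (\<alpha> g h))"

definition kappa_value ::
    "('o, 'm) category \<Rightarrow> 'o \<Rightarrow> ('o, 'm, 'a) presheaf \<Rightarrow> ('p, 'q) category
      \<Rightarrow> ('p, 'q, 'o, 'm) functor_data \<Rightarrow> ('p \<Rightarrow> 'a \<Rightarrow> 'q) \<Rightarrow> 'g monoid
      \<Rightarrow> ('g \<Rightarrow> ('p, 'q) endo) \<Rightarrow> ('g \<Rightarrow> 'g \<Rightarrow> 'p \<Rightarrow> 'q) \<Rightarrow> 'g \<Rightarrow> 'g \<Rightarrow> 'g \<Rightarrow> 'a" where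
  "kappa_value C X A Y P b G F \<alpha> g1 g2 g3 =
     (THE s. s \<in> carrier (Sec A X) \<and>
        (\<forall>x \<in> Obj Y.
           vcomp Y (vcomp Y (whisker_right (\<alpha> g1 g2) (F g3)) (\<alpha> (g1 \<otimes>\<^bsub>G\<^esub> g2) g3))
             (section_aut C X A P b (F (g1 \<otimes>\<^bsub>G\<^esub> g2 \<otimes>\<^bsub>G\<^esub> g3)) s) x
           = vcomp Y (whisker_left (F g1) (\<alpha> g2 g3)) (\<alpha> g1 (g2 \<otimes>\<^bsub>G\<^esub> g3)) x))"

definition kappa ::
    "('o, 'm) category \<Rightarrow> 'o \<Rightarrow> ('o, 'm, 'a) presheaf \<Rightarrow> ('p, 'q) category
      \<Rightarrow> ('p, 'q, 'o, 'm) functor_data \<Rightarrow> ('p \<Rightarrow> 'a \<Rightarrow> 'q) \<Rightarrow> 'g monoid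
      \<Rightarrow> ('g \<Rightarrow> ('p, 'q) endo) \<Rightarrow> ('g \<Rightarrow> 'g \<Rightarrow> 'p \<Rightarrow> 'q) \<Rightarrow> 'g list \<Rightarrow> 'a" where
  "kappa C X A Y P b G F \<alpha> =
     (\<lambda>gs \<in> tuples G 3. kappa_value C X A Y P b G F \<alpha> (gs ! 0) (gs ! 1) (gs ! 2))"

end

theory Submission
  imports Defs
begin

text \<open>Global sections of the band act on the arrows of the gerbe; composition is bilinear for this
  action, and an endomorphism \<open>F\<close> of the gerbe transforms the scalars by the map it induces on the
  band. Since objects exist and are isomorphic locally, compatible families of sections indexed by
  the objects glue, so the 2-morphisms between two endomorphisms form a torsor under the global
  sections. Hence \<open>\<kappa>\<close> is the scalar by which the two composites from \<open>F\<^bsub>ghk\<^esub>\<close> to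
  \<open>F\<^bsub>g\<^esub> F\<^bsub>h\<^esub> F\<^bsub>k\<^esub>\<close> differ. Going around the associativity pentagon in both
  directions gives the cocycle identity, and scaling the connecting 2-morphisms by a 2-cochain
  \<open>c\<close> multiplies \<open>\<kappa>\<close> by the coboundary of \<open>c\<close>.\<close>

section \<open>Gluing sections along the objects of a gerbe\<close>

text \<open>The gerbe may have no object over \<open>X\<close>, so a global section cannot in
  general be read off from a single object: both the induced map on the band and
  \<open>kappa\<close> come by descent from objects over other bases. Both are moreover definite
  descriptions, and each needs existence and uniqueness before any computation can start. In return,
  an identity of global sections is checked by letting both sides act on one arrow out of
  \<open>FObj F x\<close> for every object \<open>x\<close> and cancelling that arrow, which turns
  it into a computation with composites. The group acts strictly on the band although the
  \<open>F g\<close> compose only up to 2-isomorphism: scalars commute with the components of a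
  2-morphism, so 2-isomorphic endomorphisms induce the same map. The twist by this action in the
  coboundary formulas comes from the arrows to which some \<open>F g\<close> has been
  applied.\<close>

context fibered_in_groupoids
begin

abbreviation comp_Y :: "'q \<Rightarrow> 'q \<Rightarrow> 'q" (infixl "\<odot>" 75) where
  "g \<odot> f \<equiv> g \<cdot>\<^bsub>Y\<^esub> f"

abbreviation vertical :: "'p \<Rightarrow> 'p \<Rightarrow> 'q set" where
  "vertical x y \<equiv> HomOver Y P (Ide C (FObj P x)) x y"

lemma Hom_Obj: "\<phi> \<in> Hom Y x y \<Longrightarrow> x \<in> Obj Y" "\<phi> \<in> Hom Y x y \<Longrightarrow> y \<in> Obj Y"
  using Y.Src_Obj Y.Tgt_Obj by (auto simp: Hom_def)

lemma proj_Obj: "x \<in> Obj Y \<Longrightarrow> FObj P x \<in> Obj C"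
  using proj by (auto simp: is_functor_def)

lemma proj_Hom: "\<phi> \<in> Hom Y x y \<Longrightarrow> FArr P \<phi> \<in> Hom C (FObj P x) (FObj P y)"
  using proj by (auto simp: is_functor_def)

lemma proj_Ide: "x \<in> Obj Y \<Longrightarrow> FArr P (Ide Y x) = Ide C (FObj P x)"
  using proj by (auto simp: is_functor_def)

lemma proj_Cmp:
  "\<lbrakk>\<phi> \<in> Hom Y x y; \<psi> \<in> Hom Y y z\<rbrakk> \<Longrightarrow> FArr P (\<psi> \<odot> \<phi>) = FArr P \<psi> \<cdot>\<^bsub>C\<^esub> FArr P \<phi>"
  using proj by (auto simp: is_functor_def)

section \<open>Arrows over identities: composition, inverses, cancellation\<close>

lemma vertical_Hom: "\<phi> \<in> vertical x y \<Longrightarrow> \<phi> \<in> Hom Y x y"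
  by (simp add: HomOver_def)

lemma vertical_FArr: "\<phi> \<in> vertical x y \<Longrightarrow> FArr P \<phi> = Ide C (FObj P x)"
  by (simp add: HomOver_def)

lemma vertical_FObj:
  assumes "\<phi> \<in> vertical x y" shows "FObj P y = FObj P x"
proof -
  have "Ide C (FObj P x) \<in> Hom C (FObj P x) (FObj P y)"
    using proj_Hom[OF vertical_Hom[OF assms]] vertical_FArr[OF assms] by simp
  moreover have "Ide C (FObj P x) \<in> Hom C (FObj P x) (FObj P x)"
    using C.Ide_Hom proj_Obj Hom_Obj(1)[OF vertical_Hom[OF assms]] by blast
  ultimately show ?thesis by (simp add: Hom_def)
qed

lemma vertical_Ide: "x \<in> Obj Y \<Longrightarrow> Ide Y x \<in> vertical x x"
  by (simp add: HomOver_def Y.Ide_Hom proj_Ide)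

lemma vertical_Cmp:
  assumes "\<phi> \<in> vertical x y" "\<psi> \<in> vertical y z"
  shows "\<psi> \<odot> \<phi> \<in> vertical x z"
proof -
  have h: "\<phi> \<in> Hom Y x y" "\<psi> \<in> Hom Y y z" using assms vertical_Hom by auto
  have x: "FObj P x \<in> Obj C" using h(1) Hom_Obj proj_Obj by blast
  have "FArr P (\<psi> \<odot> \<phi>) = Ide C (FObj P x) \<cdot>\<^bsub>C\<^esub> Ide C (FObj P x)"
    using proj_Cmp[OF h] assms vertical_FArr vertical_FObj by metis
  also have "\<dots> = Ide C (FObj P x)" using C.Ide_left C.Ide_Hom x by blast
  finally show ?thesis using Y.Cmp_Hom[OF h(2,1)] by (simp add: HomOver_def)
qed

text \<open>In a category fibered in groupoids every arrow is cartesian, so it behaves as a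
  monomorphism on arrows with the same image in the base; this is the uniqueness half of
  \<open>cartesian\<close>.\<close>

lemma left_cancel:
  assumes "\<phi> \<in> Hom Y y x" "\<chi> \<in> Hom Y z y" "\<chi>' \<in> Hom Y z y" "FArr P \<chi> = FArr P \<chi>'"
    and "\<phi> \<odot> \<chi> = \<phi> \<odot> \<chi>'"
  shows "\<chi> = \<chi>'"
proof -
  have "\<exists>!\<xi>. \<xi> \<in> HomOver Y P (FArr P \<chi>) z y \<and> \<phi> \<odot> \<xi> = \<phi> \<odot> \<chi>"
    using assms(1,2) by (intro cartesian[OF _ Y.Cmp_Hom]) (auto simp: proj_Hom proj_Cmp)
  then show ?thesis using assms by (auto simp: HomOver_def)
qed

text \<open>Lifting \<open>Ide Y y\<close> through the cartesian arrow \<phi> gives a right inverse;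
  cancelling \<phi> on the left shows that it is also a left inverse.\<close>

lemma vertical_inverse:
  assumes "\<phi> \<in> vertical x y"
  obtains \<psi> where "\<psi> \<in> vertical y x" "\<psi> \<odot> \<phi> = Ide Y x" "\<phi> \<odot> \<psi> = Ide Y y"
proof -
  have h: "\<phi> \<in> Hom Y x y" and e: "FArr P \<phi> = Ide C (FObj P x)" and p: "FObj P y = FObj P x"
    using assms vertical_Hom vertical_FArr vertical_FObj by auto
  have x: "x \<in> Obj Y" and y: "y \<in> Obj Y" using h Hom_Obj by auto
  have i: "Ide C (FObj P x) \<in> Hom C (FObj P x) (FObj P x)" using C.Ide_Hom proj_Obj x by blast
  have "\<exists>!\<chi>. \<chi> \<in> HomOver Y P (Ide C (FObj P x)) y x \<and> \<phi> \<odot> \<chi> = Ide Y y"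
    using i C.Ide_left[OF i] by (intro cartesian[OF h Y.Ide_Hom[OF y]]) (auto simp: p e proj_Ide y)
  then obtain \<psi> where \<psi>: "\<psi> \<in> vertical y x" "\<phi> \<odot> \<psi> = Ide Y y" using p by auto
  have h': "\<psi> \<in> Hom Y y x" using \<psi> vertical_Hom by blast
  have "\<phi> \<odot> (\<psi> \<odot> \<phi>) = \<phi> \<odot> Ide Y x"
    using Y.Cmp_assoc[OF h h' h] \<psi>(2) Y.Ide_left[OF h] Y.Ide_right[OF h] by simp
  moreover have "\<psi> \<odot> \<phi> \<in> vertical x x" using vertical_Cmp assms \<psi>(1) by blast
  ultimately have "\<psi> \<odot> \<phi> = Ide Y x"
    using left_cancel[OF h] vertical_Ide[OF x] by (auto simp: HomOver_def)
  with \<psi> that show ?thesis by blast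
qed

lemma vertical_is_iso: "\<phi> \<in> vertical x y \<Longrightarrow> is_iso Y \<phi>"
  by (rule vertical_inverse[of \<phi> x y], assumption, frule vertical_Hom)
    (auto simp: is_iso_def HomOver_def Hom_def)

lemma vertical_right_cancel:
  assumes "\<phi> \<in> vertical x y" "\<psi> \<in> Hom Y y z" "\<psi>' \<in> Hom Y y z" "\<psi> \<odot> \<phi> = \<psi>' \<odot> \<phi>"
  shows "\<psi> = \<psi>'"
proof -
  obtain \<chi> where \<chi>: "\<chi> \<in> vertical y x" "\<phi> \<odot> \<chi> = Ide Y y"
    using assms(1) vertical_inverse by blast
  have h: "\<phi> \<in> Hom Y x y" "\<chi> \<in> Hom Y y x" using assms(1) \<chi>(1) vertical_Hom by auto
  have "\<psi> \<odot> (\<phi> \<odot> \<chi>) = \<psi>' \<odot> (\<phi> \<odot> \<chi>)"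
    using Y.Cmp_assoc[OF assms(2) h] Y.Cmp_assoc[OF assms(3) h] assms(4) by simp
  then show ?thesis using \<chi>(2) Y.Ide_right[OF assms(2)] Y.Ide_right[OF assms(3)] by simp
qed

end

section \<open>Covering sieves and separatedness of the sheaf\<close>

lemma (in site) cover_Hom: "\<lbrakk>U \<in> Obj C; S \<in> J U; f \<in> S\<rbrakk> \<Longrightarrow> f \<in> Hom C (Src C f) U"
  using cover_sieve by (fastforce simp: is_sieve_def Hom_def)

lemma (in site) cover_Cmp:
  "\<lbrakk>U \<in> Obj C; S \<in> J U; f \<in> S; g \<in> Arr C; Tgt C g = Src C f\<rbrakk> \<Longrightarrow> f \<cdot> g \<in> S"
  using cover_sieve by (fastforce simp: is_sieve_def)

lemma (in abelian_presheaf) Res_carrier: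
  "\<lbrakk>f \<in> Hom C V U; s \<in> carrier (Sec A U)\<rbrakk> \<Longrightarrow> Res A f s \<in> carrier (Sec A V)"
  using Res_hom hom_in_carrier by metis

text \<open>Both sections glue the matching family of restrictions of \<open>s\<close>, so the
  uniqueness in \<open>glue\<close> identifies them.\<close>

lemma (in abelian_sheaf) section_eqI:
  assumes U: "U \<in> Obj C" and S: "S \<in> J U"
    and s: "s \<in> carrier (Sec A U)" and t: "t \<in> carrier (Sec A U)"
    and eq: "\<And>f. f \<in> S \<Longrightarrow> Res A f s = Res A f t"
  shows "s = t"
proof -
  have "matching_family C A S (\<lambda>f. Res A f s)"
    unfolding matching_family_def
  proof (intro ballI conjI impI)
    fix f assume f: "f \<in> S"
    then show "Res A f s \<in> carrier (Sec A (Src C f))"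
      using Res_carrier cover_Hom U S s by blast
    fix g assume "g \<in> Arr C" "Tgt C g = Src C f"
    then show "Res A g (Res A f s) = Res A (f \<cdot> g) s"
      using Res_Cmp[OF cover_Hom[OF U S f], of g "Src C g" s] s by (simp add: Hom_def)
  qed
  from glue[OF U S this] s t eq show ?thesis by metis
qed

context abelian_gerbe
begin

text \<open>Local isomorphisms between objects make \<open>t f x\<close> independent of \<open>x\<close>, so a compatible family
  indexed by objects of the gerbe is a matching family on any sieve over which objects exist.\<close>

lemma glue_over_objects:
  assumes sheaf: "abelian_sheaf C J A" and U: "U \<in> Obj C"
    and tc: "\<And>x f. \<lbrakk>x \<in> Obj Y; f \<in> Hom C (FObj P x) U\<rbrakk> \<Longrightarrow> t f x \<in> carrier (Sec A (FObj P x))"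
    and tn: "\<And>x y \<phi> f. \<lbrakk>\<phi> \<in> Hom Y y x; f \<in> Hom C (FObj P x) U\<rbrakk>
      \<Longrightarrow> t (f \<cdot>\<^bsub>C\<^esub> FArr P \<phi>) y = Res A (FArr P \<phi>) (t f x)"
  shows "\<exists>!s. s \<in> carrier (Sec A U) \<and> (\<forall>x \<in> Obj Y. \<forall>f \<in> Hom C (FObj P x) U. Res A f s = t f x)"
proof -
  interpret abelian_sheaf C J A by fact
  have indep: "t f x = t f x'"
    if x: "x \<in> Obj Y" "x' \<in> Obj Y" "FObj P x = FObj P x'" and f: "f \<in> Hom C (FObj P x) U" for x x' f
  proof -
    have xC: "FObj P x \<in> Obj C" using x proj_Obj by blast
    obtain S where S: "S \<in> J (FObj P x)"
      and loc: "\<And>g. g \<in> S \<Longrightarrow> \<exists>y y' \<phi> \<psi> \<sigma>. \<phi> \<in> HomOver Y P g y x \<and> \<psi> \<in> HomOver Y P g y' x' \<and>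
                \<sigma> \<in> HomOver Y P (Ide C (Src C g)) y y'"
      using locally_isomorphic[OF x] by blast
    show ?thesis
    proof (rule section_eqI[OF xC S])
      show "t f x \<in> carrier (Sec A (FObj P x))" "t f x' \<in> carrier (Sec A (FObj P x))"
        using tc[of x f] tc[of x' f] x f by simp_all
      fix g assume g: "g \<in> S"
      obtain y y' \<phi> \<psi> \<sigma> where h: "\<phi> \<in> HomOver Y P g y x" "\<psi> \<in> HomOver Y P g y' x'"
        "\<sigma> \<in> HomOver Y P (Ide C (Src C g)) y y'"
        using loc[OF g] by blast
      have hy: "\<phi> \<in> Hom Y y x" "\<psi> \<in> Hom Y y' x'" "\<sigma> \<in> Hom Y y y'"
        and e: "FArr P \<phi> = g" "FArr P \<psi> = g" "FArr P \<sigma> = Ide C (Src C g)"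
        using h by (auto simp: HomOver_def)
      have gH: "g \<in> Hom C (FObj P y) (FObj P x)" "g \<in> Hom C (FObj P y') (FObj P x)"
        using proj_Hom[OF hy(1)] proj_Hom[OF hy(2)] e x(3) by auto
      then have src: "Src C g = FObj P y" "FObj P y' = FObj P y" by (auto simp: Hom_def)
      have fg: "f \<cdot>\<^bsub>C\<^esub> g \<in> Hom C (FObj P y') U" using Cmp_Hom f gH by blast
      have y': "y' \<in> Obj Y" using hy Hom_Obj by blast
      \<comment> \<open>The zigzag through \<phi>, \<sigma> and \<psi> moves the value from
        \<open>x\<close> to \<open>x'\<close>; restriction along \<sigma> changes nothing because
        \<sigma> lies over an identity.\<close>
      have "Res A g (t f x) = t (f \<cdot>\<^bsub>C\<^esub> g) y" using tn[OF hy(1) f] e by simp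
      also have "\<dots> = t ((f \<cdot>\<^bsub>C\<^esub> g) \<cdot>\<^bsub>C\<^esub> FArr P \<sigma>) y"
        using fg src e by (simp add: Ide_right)
      also have "\<dots> = Res A (FArr P \<sigma>) (t (f \<cdot>\<^bsub>C\<^esub> g) y')" using tn[OF hy(3) fg] .
      also have "\<dots> = t (f \<cdot>\<^bsub>C\<^esub> g) y'"
        using Res_Ide[of "FObj P y'"] tc[OF y' fg] proj_Obj[OF y'] e src by simp
      also have "\<dots> = Res A g (t f x')" using tn[OF hy(2)] f x e by simp
      finally show "Res A g (t f x) = Res A g (t f x')" .
    qed
  qed
  obtain S where S: "S \<in> J U" and "\<And>f. f \<in> S \<Longrightarrow> \<exists>x \<in> Obj Y. FObj P x = Src C f"
    using locally_nonempty[OF U] by blast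
  \<comment> \<open>Selects one object over the source of each arrow in the sieve. By
    \<open>indep\<close> the choice does not affect the values of \<open>t\<close>.\<close>
  then obtain z where z: "\<And>f. f \<in> S \<Longrightarrow> z f \<in> Obj Y" "\<And>f. f \<in> S \<Longrightarrow> FObj P (z f) = Src C f"
    by metis
  have SH: "\<And>f. f \<in> S \<Longrightarrow> f \<in> Hom C (FObj P (z f)) U" using cover_Hom U S z by simp
  have restr: "Res A g (t f x) = t (f \<cdot>\<^bsub>C\<^esub> g) (z (f \<cdot>\<^bsub>C\<^esub> g))"
    if x: "x \<in> Obj Y" and f: "f \<in> Hom C (FObj P x) U"
      and g: "g \<in> Hom C V (FObj P x)" and fg: "f \<cdot>\<^bsub>C\<^esub> g \<in> S" for x f g V
  proof -
    \<comment> \<open>A pullback of \<open>x\<close> along \<open>g\<close> and the selected object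
      both lie over \<open>V\<close>, so \<open>indep\<close> lets one replace the other.\<close>
    obtain y \<phi> where \<phi>: "\<phi> \<in> HomOver Y P g y x" using pullback_ex[OF x g] by blast
    then have \<phi>': "\<phi> \<in> Hom Y y x" "FArr P \<phi> = g" by (auto simp: HomOver_def)
    have y: "y \<in> Obj Y" using \<phi>' Hom_Obj by blast
    have "FObj P y = V" using proj_Hom[OF \<phi>'(1)] \<phi>'(2) g by (simp add: Hom_def)
    moreover have "f \<cdot>\<^bsub>C\<^esub> g \<in> Hom C V U" using Cmp_Hom f g by blast
    ultimately have "t (f \<cdot>\<^bsub>C\<^esub> g) y = t (f \<cdot>\<^bsub>C\<^esub> g) (z (f \<cdot>\<^bsub>C\<^esub> g))"
      using indep[OF y z(1)[OF fg]] z(2)[OF fg] by (simp add: Hom_def)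
    then show ?thesis using tn[OF \<phi>'(1) f] \<phi>'(2) by simp
  qed
  have "matching_family C A S (\<lambda>f. t f (z f))"
    unfolding matching_family_def
  proof (intro ballI conjI impI)
    fix f assume f: "f \<in> S"
    show "t f (z f) \<in> carrier (Sec A (Src C f))" using tc[OF z(1)[OF f] SH[OF f]] z(2)[OF f] by simp
    fix g assume g: "g \<in> Arr C" "Tgt C g = Src C f"
    show "Res A g (t f (z f)) = t (f \<cdot>\<^bsub>C\<^esub> g) (z (f \<cdot>\<^bsub>C\<^esub> g))"
      using restr[OF z(1)[OF f] SH[OF f]] g cover_Cmp[OF U S f g] z(2)[OF f] by (simp add: Hom_def)
  qed
  from glue[OF U S this] obtain s where s: "s \<in> carrier (Sec A U)"
    and sf: "\<And>f. f \<in> S \<Longrightarrow> Res A f s = t f (z f)" by blast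
  show ?thesis
  proof (rule ex1I[of _ s], intro conjI ballI s)
    fix x f assume x: "x \<in> Obj Y" and f: "f \<in> Hom C (FObj P x) U"
    \<comment> \<open>The glued section is known to agree with \<open>t\<close> only at the selected
      objects. The comparison at an arbitrary \<open>x\<close> is therefore made on the pulled back
      sieve, whose arrows compose with \<open>f\<close> into \<open>S\<close>.\<close>
    have cov: "pull_sieve C f S \<in> J (FObj P x)" using cover_pull f S by blast
    show "Res A f s = t f x"
    proof (rule section_eqI[OF proj_Obj[OF x] cov Res_carrier[OF f s] tc[OF x f]])
      fix g assume "g \<in> pull_sieve C f S"
      then have g: "g \<in> Hom C (Src C g) (FObj P x)" "f \<cdot>\<^bsub>C\<^esub> g \<in> S"
        using f by (auto simp: pull_sieve_def Hom_def)
      show "Res A g (Res A f s) = Res A g (t f x)"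
        using Res_Cmp[OF f g(1) s] sf[OF g(2)] restr[OF x f g] by simp
    qed
  next
    fix s' assume s': "s' \<in> carrier (Sec A U) \<and>
      (\<forall>x \<in> Obj Y. \<forall>f \<in> Hom C (FObj P x) U. Res A f s' = t f x)"
    have "Res A f s' = Res A f s" if "f \<in> S" for f
      using s' sf[OF that] z(1)[OF that] SH[OF that] by simp
    then show "s' = s" using section_eqI[OF U S _ s] s' by blast
  qed
qed

end

section \<open>The map induced on the band\<close>

lemma func_comp_simps [simp]:
  "FObj (func_comp F H) x = FObj F (FObj H x)" "FArr (func_comp F H) \<phi> = FArr F (FArr H \<phi>)"
  by (simp_all add: func_comp_def)

section \<open>Endomorphisms of a fibered category and their 2-morphisms\<close>

context fibered_in_groupoids
begin

context
  fixes F :: "('p, 'q) endo"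
  assumes F: "gerbe_endo Y P F"
begin

lemma endo_Obj: "x \<in> Obj Y \<Longrightarrow> FObj F x \<in> Obj Y"
  using F by (auto simp: gerbe_endo_def is_functor_def)

lemma endo_FObj: "x \<in> Obj Y \<Longrightarrow> FObj P (FObj F x) = FObj P x"
  using F by (auto simp: gerbe_endo_def)

lemma endo_Hom: "\<phi> \<in> Hom Y x y \<Longrightarrow> FArr F \<phi> \<in> Hom Y (FObj F x) (FObj F y)"
  using F by (auto simp: gerbe_endo_def is_functor_def)

lemma endo_FArr: "\<phi> \<in> Hom Y x y \<Longrightarrow> FArr P (FArr F \<phi>) = FArr P \<phi>"
  using F by (auto simp: gerbe_endo_def Hom_def)

lemma endo_Cmp:
  "\<lbrakk>\<phi> \<in> Hom Y x y; \<psi> \<in> Hom Y y z\<rbrakk> \<Longrightarrow> FArr F (\<psi> \<odot> \<phi>) = FArr F \<psi> \<odot> FArr F \<phi>"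
  using F by (auto simp: gerbe_endo_def is_functor_def)

lemma endo_vertical:
  assumes "\<phi> \<in> vertical x y" shows "FArr F \<phi> \<in> vertical (FObj F x) (FObj F y)"
  using endo_Hom[OF vertical_Hom[OF assms]] endo_FArr[OF vertical_Hom[OF assms]]
    endo_FObj[OF Hom_Obj(1)[OF vertical_Hom[OF assms]]] assms
  by (simp add: HomOver_def)

end

lemma gerbe_endo_comp:
  assumes F: "gerbe_endo Y P F" and H: "gerbe_endo Y P H"
  shows "gerbe_endo Y P (func_comp F H)"
proof -
  have "FArr H \<phi> \<in> Arr Y" if "\<phi> \<in> Arr Y" for \<phi>
    using endo_Hom[OF H, of \<phi> "Src Y \<phi>" "Tgt Y \<phi>"] that by (simp add: Hom_def)
  moreover have "FArr F (FArr H (g \<odot> f)) = FArr F (FArr H g) \<odot> FArr F (FArr H f)"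
    if "f \<in> Hom Y x y" "g \<in> Hom Y y z" for f g x y z
    using endo_Cmp[OF H that] endo_Cmp[OF F endo_Hom[OF H that(1)] endo_Hom[OF H that(2)]] by simp
  ultimately show ?thesis
    using assms by (simp add: gerbe_endo_def is_functor_def)
qed

text \<open>The definition places the components over the identity of \<open>FObj P x\<close>,
  whereas \<open>vertical\<close> refers to the base of \<open>FObj F x\<close>; the two agree
  because \<open>F\<close> preserves the projection.\<close>

lemma two_morphism_vertical:
  assumes "two_morphism C Y P F F' \<eta>" "gerbe_endo Y P F" "x \<in> Obj Y"
  shows "\<eta> x \<in> vertical (FObj F x) (FObj F' x)"
  using assms endo_FObj by (auto simp: two_morphism_def)

lemma two_morphism_natural:
  assumes "two_morphism C Y P F F' \<eta>" "\<phi> \<in> Hom Y x y"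
  shows "\<eta> y \<odot> FArr F \<phi> = FArr F' \<phi> \<odot> \<eta> x"
  using assms by (auto simp: two_morphism_def)

lemma two_morphism_vcomp:
  assumes F: "gerbe_endo Y P F" "gerbe_endo Y P F'" "gerbe_endo Y P F''"
    and \<eta>: "two_morphism C Y P F F' \<eta>" and \<theta>: "two_morphism C Y P F' F'' \<theta>"
  shows "two_morphism C Y P F F'' (vcomp Y \<theta> \<eta>)"
  unfolding two_morphism_def vcomp_def
proof (intro conjI ballI allI)
  fix x assume x: "x \<in> Obj Y"
  show "\<theta> x \<odot> \<eta> x \<in> HomOver Y P (Ide C (FObj P x)) (FObj F x) (FObj F'' x)"
    using vertical_Cmp[OF two_morphism_vertical[OF \<eta> F(1) x] two_morphism_vertical[OF \<theta> F(2) x]]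
      endo_FObj[OF F(1) x] by simp
next
  fix x y \<phi> assume \<phi>: "\<phi> \<in> Hom Y x y"
  then have x: "x \<in> Obj Y" "y \<in> Obj Y" using Hom_Obj by auto
  note h = two_morphism_vertical[OF \<eta> F(1), THEN vertical_Hom]
    two_morphism_vertical[OF \<theta> F(2), THEN vertical_Hom]
  have "\<theta> y \<odot> \<eta> y \<odot> FArr F \<phi> = \<theta> y \<odot> (FArr F' \<phi> \<odot> \<eta> x)"
    using Y.Cmp_assoc[OF h(2)[OF x(2)] h(1)[OF x(2)] endo_Hom[OF F(1) \<phi>]]
      two_morphism_natural[OF \<eta> \<phi>] by simp
  also have "\<dots> = FArr F'' \<phi> \<odot> \<theta> x \<odot> \<eta> x"
    using Y.Cmp_assoc[OF h(2)[OF x(2)] endo_Hom[OF F(2) \<phi>] h(1)[OF x(1)]]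
      two_morphism_natural[OF \<theta> \<phi>] by simp
  also have "\<dots> = FArr F'' \<phi> \<odot> (\<theta> x \<odot> \<eta> x)"
    using Y.Cmp_assoc[OF endo_Hom[OF F(3) \<phi>] h(2)[OF x(1)] h(1)[OF x(1)]] .
  finally show "\<theta> y \<odot> \<eta> y \<odot> FArr F \<phi> = FArr F'' \<phi> \<odot> (\<theta> x \<odot> \<eta> x)" .
qed

lemma two_morphism_whisker_right:
  assumes "gerbe_endo Y P H" "two_morphism C Y P F F' \<eta>"
  shows "two_morphism C Y P (func_comp F H) (func_comp F' H) (whisker_right \<eta> H)"
  unfolding two_morphism_def whisker_right_def
proof (intro conjI ballI allI)
  fix x assume "x \<in> Obj Y"
  then show "\<eta> (FObj H x) \<in> HomOver Y P (Ide C (FObj P x)) (FObj (func_comp F H) x) (FObj (func_comp F' H) x)"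
    using assms(2) endo_Obj[OF assms(1)] endo_FObj[OF assms(1)] by (force simp: two_morphism_def)
next
  fix x y \<phi> assume "\<phi> \<in> Hom Y x y"
  then show "\<eta> (FObj H y) \<odot> FArr (func_comp F H) \<phi> = FArr (func_comp F' H) \<phi> \<odot> \<eta> (FObj H x)"
    using two_morphism_natural[OF assms(2)] endo_Hom[OF assms(1)] by simp
qed

lemma two_morphism_whisker_left:
  assumes H: "gerbe_endo Y P H" and F: "gerbe_endo Y P F" "gerbe_endo Y P F'"
    and \<eta>: "two_morphism C Y P F F' \<eta>"
  shows "two_morphism C Y P (func_comp H F) (func_comp H F') (whisker_left H \<eta>)"
  unfolding two_morphism_def whisker_left_def
proof (intro conjI ballI allI)
  fix x assume x: "x \<in> Obj Y"
  show "FArr H (\<eta> x) \<in> HomOver Y P (Ide C (FObj P x)) (FObj (func_comp H F) x) (FObj (func_comp H F') x)"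
    using endo_vertical[OF H two_morphism_vertical[OF \<eta> F(1) x]] endo_FObj[OF F(1) x]
      endo_FObj[OF H endo_Obj[OF F(1) x]] by simp
next
  fix x y \<phi> assume \<phi>: "\<phi> \<in> Hom Y x y"
  then have x: "x \<in> Obj Y" "y \<in> Obj Y" using Hom_Obj by auto
  note h = two_morphism_vertical[OF \<eta> F(1), THEN vertical_Hom]
  have "FArr H (\<eta> y) \<odot> FArr H (FArr F \<phi>) = FArr H (FArr F' \<phi>) \<odot> FArr H (\<eta> x)"
    using endo_Cmp[OF H endo_Hom[OF F(1) \<phi>] h[OF x(2)]] endo_Cmp[OF H h[OF x(1)] endo_Hom[OF F(2) \<phi>]]
      two_morphism_natural[OF \<eta> \<phi>] by simp
  then show "FArr H (\<eta> y) \<odot> FArr (func_comp H F) \<phi> = FArr (func_comp H F') \<phi> \<odot> FArr H (\<eta> x)"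
    by simp
qed

end

section \<open>Automorphisms as scalars, and how endomorphisms transform them\<close>

context banded_gerbe
begin

lemma Sec_group: "U \<in> Obj C \<Longrightarrow> group (Sec A U)"
  using Sec_comm_group comm_group.axioms(2) by blast

lemma carrier_aut_group: "x \<in> Obj Y \<Longrightarrow> carrier (aut_group C Y P x) = vertical x x"
  using vertical_is_iso by (auto simp: aut_group_def)

lemma band_hom: "x \<in> Obj Y \<Longrightarrow> b x \<in> hom (Sec A (FObj P x)) (aut_group C Y P x)"
  using band_iso by (auto simp: iso_def)

lemma band_bij: "x \<in> Obj Y \<Longrightarrow> bij_betw (b x) (carrier (Sec A (FObj P x))) (vertical x x)"
  using band_iso carrier_aut_group by (auto simp: iso_def)

lemma band_vertical: "\<lbrakk>x \<in> Obj Y; s \<in> carrier (Sec A (FObj P x))\<rbrakk> \<Longrightarrow> b x s \<in> vertical x x"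
  using band_bij bij_betwE by blast

lemma band_mult:
  "\<lbrakk>x \<in> Obj Y; s \<in> carrier (Sec A (FObj P x)); t \<in> carrier (Sec A (FObj P x))\<rbrakk>
    \<Longrightarrow> b x (s \<otimes>\<^bsub>Sec A (FObj P x)\<^esub> t) = b x s \<odot> b x t"
  using hom_mult[OF band_hom] by (simp add: aut_group_def)

lemma band_inj:
  "\<lbrakk>x \<in> Obj Y; s \<in> carrier (Sec A (FObj P x)); t \<in> carrier (Sec A (FObj P x)); b x s = b x t\<rbrakk>
    \<Longrightarrow> s = t"
  using bij_betw_imp_inj_on[OF band_bij] by (meson inj_onD)

lemma band_surj:
  "\<lbrakk>x \<in> Obj Y; \<sigma> \<in> vertical x x\<rbrakk> \<Longrightarrow> \<exists>s \<in> carrier (Sec A (FObj P x)). b x s = \<sigma>"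
  using bij_betw_imp_surj_on[OF band_bij] by (metis imageE)

text \<open>Characterises the value \<open>r\<close> at \<open>s\<close> without an object over
  \<open>U\<close>: the test runs over all objects whose base maps to \<open>U\<close>, and over
  every arrow \<open>f\<close> by which it does so.\<close>

definition induced_section :: "('p, 'q) endo \<Rightarrow> 'o \<Rightarrow> 'a \<Rightarrow> 'a \<Rightarrow> bool" where
  "induced_section F U s r \<longleftrightarrow> r \<in> carrier (Sec A U) \<and>
     (\<forall>x \<in> Obj Y. \<forall>f \<in> Hom C (FObj P x) U.
        FArr F (b x (Res A f s)) = b (FObj F x) (Res A f r))"

text \<open>Each \<open>FArr F (b x (Res A f s))\<close> is a vertical automorphism of
  \<open>FObj F x\<close>, hence given by a unique section over the base of \<open>x\<close>.
  Naturality of the band makes these sections compatible, and they glue along the objects.\<close>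

lemma ex1_induced_section:
  assumes F: "gerbe_endo Y P F" and U: "U \<in> Obj C" and s: "s \<in> carrier (Sec A U)"
  shows "\<exists>!r. induced_section F U s r"
proof -
  define t where "t = (\<lambda>f x. SOME r. r \<in> carrier (Sec A (FObj P x)) \<and>
    b (FObj F x) r = FArr F (b x (Res A f s)))"
  have t: "t f x \<in> carrier (Sec A (FObj P x)) \<and> b (FObj F x) (t f x) = FArr F (b x (Res A f s))"
    if x: "x \<in> Obj Y" and f: "f \<in> Hom C (FObj P x) U" for x f
  proof -
    have "FArr F (b x (Res A f s)) \<in> vertical (FObj F x) (FObj F x)"
      using endo_vertical[OF F band_vertical[OF x Res_carrier[OF f s]]] .
    then have "\<exists>r. r \<in> carrier (Sec A (FObj P x)) \<and> b (FObj F x) r = FArr F (b x (Res A f s))"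
      using band_surj[OF endo_Obj[OF F x]] endo_FObj[OF F x] by auto
    then show ?thesis unfolding t_def by (rule someI_ex)
  qed
  have nat: "t (f \<cdot>\<^bsub>C\<^esub> FArr P \<phi>) y = Res A (FArr P \<phi>) (t f x)"
    if \<phi>: "\<phi> \<in> Hom Y y x" and f: "f \<in> Hom C (FObj P x) U" for x y \<phi> f
  proof -
    have x: "x \<in> Obj Y" and y: "y \<in> Obj Y" using Hom_Obj \<phi> by auto
    note Fx = endo_Obj[OF F x] and Fy = endo_Obj[OF F y]
    note Px = endo_FObj[OF F x] and Py = endo_FObj[OF F y]
    note P\<phi> = proj_Hom[OF \<phi>] and F\<phi> = endo_Hom[OF F \<phi>]
    have f\<phi>: "f \<cdot>\<^bsub>C\<^esub> FArr P \<phi> \<in> Hom C (FObj P y) U" using Cmp_Hom[OF f P\<phi>] .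
    have r: "Res A (FArr P \<phi>) (t f x) \<in> carrier (Sec A (FObj P y))"
      using Res_carrier[OF P\<phi>] t[OF x f] by blast
    let ?p = "b x (Res A f s)" and ?q = "b y (Res A (f \<cdot>\<^bsub>C\<^esub> FArr P \<phi>) s)"
    have pq: "?p \<in> vertical x x" "?q \<in> vertical y y"
      using band_vertical[OF x Res_carrier[OF f s]] band_vertical[OF y Res_carrier[OF f\<phi> s]] by auto
    \<comment> \<open>Both candidates are composed with \<open>FArr F \<phi>\<close>, which is
      cancelled afterwards. Naturality of the band is used twice: along \<phi> before applying
      \<open>F\<close>, and along \<open>FArr F \<phi>\<close> after it.\<close>
    have "FArr F \<phi> \<odot> b (FObj F y) (t (f \<cdot>\<^bsub>C\<^esub> FArr P \<phi>) y) = FArr F (\<phi> \<odot> ?q)"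
      using t[OF y f\<phi>] endo_Cmp[OF F vertical_Hom[OF pq(2)] \<phi>] by simp
    also have "\<phi> \<odot> ?q = ?p \<odot> \<phi>"
      using band_natural[OF \<phi> Res_carrier[OF f s]] Res_Cmp[OF f P\<phi> s] by simp
    also have "FArr F (?p \<odot> \<phi>) = b (FObj F x) (t f x) \<odot> FArr F \<phi>"
      using t[OF x f] endo_Cmp[OF F \<phi> vertical_Hom[OF pq(1)]] by simp
    also have "\<dots> = FArr F \<phi> \<odot> b (FObj F y) (Res A (FArr P \<phi>) (t f x))"
      using band_natural[OF F\<phi>, of "t f x"] t[OF x f] Px endo_FArr[OF F \<phi>] by simp
    finally have "FArr F \<phi> \<odot> b (FObj F y) (t (f \<cdot>\<^bsub>C\<^esub> FArr P \<phi>) y)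
      = FArr F \<phi> \<odot> b (FObj F y) (Res A (FArr P \<phi>) (t f x))" .
    moreover have "b (FObj F y) (t (f \<cdot>\<^bsub>C\<^esub> FArr P \<phi>) y) \<in> vertical (FObj F y) (FObj F y)"
      "b (FObj F y) (Res A (FArr P \<phi>) (t f x)) \<in> vertical (FObj F y) (FObj F y)"
      using band_vertical[OF Fy, unfolded Py] conjunct1[OF t[OF y f\<phi>]] r Py by simp_all
    ultimately have "b (FObj F y) (t (f \<cdot>\<^bsub>C\<^esub> FArr P \<phi>) y) = b (FObj F y) (Res A (FArr P \<phi>) (t f x))"
      using left_cancel[OF F\<phi>] by (auto simp: HomOver_def)
    then show ?thesis using band_inj[OF Fy, unfolded Py] conjunct1[OF t[OF y f\<phi>]] r by blast
  qed
  have "\<exists>!r. r \<in> carrier (Sec A U) \<and> (\<forall>x \<in> Obj Y. \<forall>f \<in> Hom C (FObj P x) U. Res A f r = t f x)"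
    using t nat by (intro glue_over_objects[OF abelian_sheaf_axioms U]) auto
  \<comment> \<open>Injectivity of \<open>b (FObj F x)\<close> translates between equality of
    sections and equality of automorphisms.\<close>
  moreover have "(r \<in> carrier (Sec A U) \<and> (\<forall>x \<in> Obj Y. \<forall>f \<in> Hom C (FObj P x) U. Res A f r = t f x))
      \<longleftrightarrow> induced_section F U s r" for r
  proof -
    have "Res A f r = t f x \<longleftrightarrow> FArr F (b x (Res A f s)) = b (FObj F x) (Res A f r)"
      if "r \<in> carrier (Sec A U)" "x \<in> Obj Y" "f \<in> Hom C (FObj P x) U" for x f
      using t[OF that(2,3)] band_inj[OF endo_Obj[OF F that(2)], of "Res A f r" "t f x"]
        endo_FObj[OF F that(2)] Res_carrier[OF that(3,1)] by auto
    then show ?thesis unfolding induced_section_def by blast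
  qed
  ultimately show ?thesis by simp
qed

text \<open>Together with \<open>ex1_induced_section\<close> this determines, on all sections, any
  map that induces the effect of \<open>F\<close> on the band.\<close>

lemma induces_on_band_section:
  assumes \<phi>: "induces_on_band C A Y P b F \<phi>" and U: "U \<in> Obj C" and s: "s \<in> carrier (Sec A U)"
  shows "induced_section F U s (\<phi> U s)"
  unfolding induced_section_def
proof (intro conjI ballI)
  have \<phi>h: "\<And>U. U \<in> Obj C \<Longrightarrow> \<phi> U \<in> hom (Sec A U) (Sec A U)"
    using \<phi> by (auto simp: induces_on_band_def sheaf_endo_def)
  then show "\<phi> U s \<in> carrier (Sec A U)" using U s hom_in_carrier by metis
  fix x f assume x: "x \<in> Obj Y" and f: "f \<in> Hom C (FObj P x) U"
  have "FArr F (b x (Res A f s)) = b (FObj F x) (\<phi> (FObj P x) (Res A f s))"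
    using \<phi> x Res_carrier[OF f s] by (auto simp: induces_on_band_def)
  also have "\<phi> (FObj P x) (Res A f s) = Res A f (\<phi> U s)"
    using \<phi> f s by (auto simp: induces_on_band_def sheaf_endo_def)
  finally show "FArr F (b x (Res A f s)) = b (FObj F x) (Res A f (\<phi> U s))" .
qed

text \<open>By uniqueness of induced sections, this forces the pointwise defined map to be a
  homomorphism; \<open>induced_section_Res\<close> forces compatibility with restriction in the same
  way.\<close>

lemma induced_section_mult:
  assumes F: "gerbe_endo Y P F" and U: "U \<in> Obj C"
    and s: "s \<in> carrier (Sec A U)" "s' \<in> carrier (Sec A U)"
    and r: "induced_section F U s r" "induced_section F U s' r'"
  shows "induced_section F U (s \<otimes>\<^bsub>Sec A U\<^esub> s') (r \<otimes>\<^bsub>Sec A U\<^esub> r')"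
  unfolding induced_section_def
proof (intro conjI ballI)
  have rc: "r \<in> carrier (Sec A U)" "r' \<in> carrier (Sec A U)"
    using r by (auto simp: induced_section_def)
  interpret group "Sec A U" using Sec_group U .
  show "r \<otimes>\<^bsub>Sec A U\<^esub> r' \<in> carrier (Sec A U)" using rc by simp
  fix x f assume x: "x \<in> Obj Y" and f: "f \<in> Hom C (FObj P x) U"
  note Fx = endo_Obj[OF F x] and Px = endo_FObj[OF F x] and R = Res_carrier[OF f]
  have "FArr F (b x (Res A f (s \<otimes>\<^bsub>Sec A U\<^esub> s'))) = FArr F (b x (Res A f s) \<odot> b x (Res A f s'))"
    using hom_mult[OF Res_hom[OF f] s] band_mult[OF x R R] s by simp
  also have "\<dots> = FArr F (b x (Res A f s)) \<odot> FArr F (b x (Res A f s'))"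
    using endo_Cmp[OF F band_vertical[OF x R, THEN vertical_Hom] band_vertical[OF x R, THEN vertical_Hom]] s
    by simp
  also have "\<dots> = b (FObj F x) (Res A f r) \<odot> b (FObj F x) (Res A f r')"
    using r x f by (simp add: induced_section_def)
  also have "\<dots> = b (FObj F x) (Res A f (r \<otimes>\<^bsub>Sec A U\<^esub> r'))"
    using hom_mult[OF Res_hom[OF f] rc] band_mult[OF Fx, of "Res A f r" "Res A f r'"] Px R rc by simp
  finally show "FArr F (b x (Res A f (s \<otimes>\<^bsub>Sec A U\<^esub> s'))) = b (FObj F x) (Res A f (r \<otimes>\<^bsub>Sec A U\<^esub> r'))" .
qed

lemma induced_section_Res:
  assumes f: "f \<in> Hom C V U" and s: "s \<in> carrier (Sec A U)" and r: "induced_section F U s r"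
  shows "induced_section F V (Res A f s) (Res A f r)"
  unfolding induced_section_def
proof (intro conjI ballI)
  have rc: "r \<in> carrier (Sec A U)" using r by (auto simp: induced_section_def)
  then show "Res A f r \<in> carrier (Sec A V)" using Res_carrier f by blast
  fix x g assume x: "x \<in> Obj Y" and g: "g \<in> Hom C (FObj P x) V"
  show "FArr F (b x (Res A g (Res A f s))) = b (FObj F x) (Res A g (Res A f r))"
    using r x Cmp_Hom[OF f g]
    by (auto simp: induced_section_def simp flip: Res_Cmp[OF f g s] Res_Cmp[OF f g rc])
qed

lemma ex1_band_map:
  assumes F: "gerbe_endo Y P F"
  shows "\<exists>!\<phi>. induces_on_band C A Y P b F \<phi> \<and>
    \<phi> \<in> (\<Pi>\<^sub>E U \<in> Obj C. carrier (Sec A U) \<rightarrow>\<^sub>E carrier (Sec A U))"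
proof (rule ex_ex1I)
  define \<phi> where "\<phi> = (\<lambda>U \<in> Obj C. \<lambda>s \<in> carrier (Sec A U). THE r. induced_section F U s r)"
  have \<phi>: "induced_section F U s (\<phi> U s)" if "U \<in> Obj C" "s \<in> carrier (Sec A U)" for U s
    using theI'[OF ex1_induced_section[OF F that]] that by (simp add: \<phi>_def)
  have eq: "\<phi> U s = r" if "U \<in> Obj C" "s \<in> carrier (Sec A U)" "induced_section F U s r" for U s r
    using ex1_induced_section[OF F that(1,2)] that(3) \<phi>[OF that(1,2)] by blast
  have car: "\<phi> U s \<in> carrier (Sec A U)" if "U \<in> Obj C" "s \<in> carrier (Sec A U)" for U s
    using \<phi>[OF that] by (simp add: induced_section_def)
  have "sheaf_endo C A \<phi>"
    unfolding sheaf_endo_def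
  proof (intro conjI ballI allI)
    fix U assume U: "U \<in> Obj C"
    interpret group "Sec A U" using Sec_group U .
    show "\<phi> U \<in> hom (Sec A U) (Sec A U)"
      using car[OF U] eq[OF U _ induced_section_mult[OF F U _ _ \<phi>[OF U] \<phi>[OF U]]]
      by (intro homI) auto
  next
    fix U V f s assume f: "f \<in> Hom C V U" and s: "s \<in> carrier (Sec A U)"
    have UV: "U \<in> Obj C" "V \<in> Obj C" using f Src_Obj Tgt_Obj by (auto simp: Hom_def)
    show "\<phi> V (Res A f s) = Res A f (\<phi> U s)"
      using eq[OF UV(2) Res_carrier[OF f s]] induced_section_Res[OF f s \<phi>[OF UV(1) s]] by blast
  qed
  moreover have "FArr F (b x s) = b (FObj F x) (\<phi> (FObj P x) s)"
    if x: "x \<in> Obj Y" and s: "s \<in> carrier (Sec A (FObj P x))" for x s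
  proof -
    note Px = proj_Obj[OF x]
    \<comment> \<open>Taking for \<open>f\<close> the identity of the base of \<open>x\<close> in
      \<open>induced_section\<close> recovers the formula at \<open>x\<close> itself.\<close>
    show ?thesis
      using \<phi>[OF Px s] x Ide_Hom[OF Px] Res_Ide[OF Px s] Res_Ide[OF Px car[OF Px s]]
      unfolding induced_section_def by metis
  qed
  moreover have "\<phi> \<in> (\<Pi>\<^sub>E U \<in> Obj C. carrier (Sec A U) \<rightarrow>\<^sub>E carrier (Sec A U))"
    using car by (auto simp: \<phi>_def)
  ultimately show "\<exists>\<phi>. induces_on_band C A Y P b F \<phi> \<and>
      \<phi> \<in> (\<Pi>\<^sub>E U \<in> Obj C. carrier (Sec A U) \<rightarrow>\<^sub>E carrier (Sec A U))"
    by (auto simp: induces_on_band_def)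
next
  fix \<phi> \<psi>
  assume \<phi>: "induces_on_band C A Y P b F \<phi> \<and>
      \<phi> \<in> (\<Pi>\<^sub>E U \<in> Obj C. carrier (Sec A U) \<rightarrow>\<^sub>E carrier (Sec A U))"
    and \<psi>: "induces_on_band C A Y P b F \<psi> \<and>
      \<psi> \<in> (\<Pi>\<^sub>E U \<in> Obj C. carrier (Sec A U) \<rightarrow>\<^sub>E carrier (Sec A U))"
  have "\<phi> U s = \<psi> U s" if "U \<in> Obj C" "s \<in> carrier (Sec A U)" for U s
    using induces_on_band_section[OF conjunct1[OF \<phi>] that] induces_on_band_section[OF conjunct1[OF \<psi>] that]
      ex1_induced_section[OF F that] by blast
  then have "\<phi> U = \<psi> U" if "U \<in> Obj C" for U
    using PiE_mem[OF conjunct2[OF \<phi>] that] PiE_mem[OF conjunct2[OF \<psi>] that] that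
    by (blast intro: PiE_ext)
  then show "\<phi> = \<psi>" using conjunct2[OF \<phi>] conjunct2[OF \<psi>] by (rule PiE_ext[rotated 2])
qed

lemma induces_band_map:
  "gerbe_endo Y P F \<Longrightarrow> induces_on_band C A Y P b F (band_map C A Y P b F)"
  unfolding band_map_def using theI'[OF ex1_band_map] by blast

text \<open>The description of \<open>band_map\<close> asks for an extensional function, while here
  \<phi> is arbitrary outside the carriers. Composites of induced maps can thus be fed in
  directly.\<close>

lemma band_map_eqI:
  assumes "gerbe_endo Y P F" "induces_on_band C A Y P b F \<phi>" "U \<in> Obj C" "s \<in> carrier (Sec A U)"
  shows "band_map C A Y P b F U s = \<phi> U s"
  using ex1_induced_section[OF assms(1,3,4)] induces_on_band_section[OF assms(2-)]
    induces_on_band_section[OF induces_band_map[OF assms(1)] assms(3,4)] by blast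

lemma band_map_hom:
  "\<lbrakk>gerbe_endo Y P F; U \<in> Obj C\<rbrakk> \<Longrightarrow> band_map C A Y P b F U \<in> hom (Sec A U) (Sec A U)"
  using induces_band_map by (auto simp: induces_on_band_def sheaf_endo_def)

lemma band_map_Res:
  "\<lbrakk>gerbe_endo Y P F; f \<in> Hom C V U; s \<in> carrier (Sec A U)\<rbrakk>
    \<Longrightarrow> band_map C A Y P b F V (Res A f s) = Res A f (band_map C A Y P b F U s)"
  using induces_band_map by (auto simp: induces_on_band_def sheaf_endo_def)

lemma FArr_band:
  "\<lbrakk>gerbe_endo Y P F; x \<in> Obj Y; s \<in> carrier (Sec A (FObj P x))\<rbrakk>
    \<Longrightarrow> FArr F (b x s) = b (FObj F x) (band_map C A Y P b F (FObj P x) s)"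
  using induces_band_map by (auto simp: induces_on_band_def)

lemma induces_on_band_comp:
  assumes H: "gerbe_endo Y P H"
    and \<phi>: "induces_on_band C A Y P b F \<phi>" and \<psi>: "induces_on_band C A Y P b H \<psi>"
  shows "induces_on_band C A Y P b (func_comp F H) (\<lambda>U s. \<phi> U (\<psi> U s))"
proof -
  have c: "\<And>U s. \<lbrakk>U \<in> Obj C; s \<in> carrier (Sec A U)\<rbrakk> \<Longrightarrow> \<psi> U s \<in> carrier (Sec A U)"
    using induces_on_band_section[OF \<psi>] by (auto simp: induced_section_def)
  have "sheaf_endo C A (\<lambda>U s. \<phi> U (\<psi> U s))"
    unfolding sheaf_endo_def
  proof (intro conjI ballI allI)
    fix U assume U: "U \<in> Obj C"
    then have "\<phi> U \<in> hom (Sec A U) (Sec A U)" "\<psi> U \<in> hom (Sec A U) (Sec A U)"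
      using \<phi> \<psi> by (simp_all add: induces_on_band_def sheaf_endo_def)
    then show "(\<lambda>s. \<phi> U (\<psi> U s)) \<in> hom (Sec A U) (Sec A U)"
      using hom_compose by (fastforce simp: comp_def)
  next
    fix U V f s assume f: "f \<in> Hom C V U" and s: "s \<in> carrier (Sec A U)"
    have "U \<in> Obj C" using f Tgt_Obj by (auto simp: Hom_def)
    then show "\<phi> V (\<psi> V (Res A f s)) = Res A f (\<phi> U (\<psi> U s))"
      using \<phi> \<psi> f s c by (simp add: induces_on_band_def sheaf_endo_def)
  qed
  moreover have "FArr F (FArr H (b x s)) = b (FObj F (FObj H x)) (\<phi> (FObj P x) (\<psi> (FObj P x) s))"
    if x: "x \<in> Obj Y" and s: "s \<in> carrier (Sec A (FObj P x))" for x s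
    using \<phi> \<psi> x s c[OF proj_Obj[OF x] s] endo_Obj[OF H x] endo_FObj[OF H x]
    by (simp add: induces_on_band_def)
  ultimately show ?thesis by (simp add: induces_on_band_def)
qed

text \<open>The component of \<eta> at \<open>x\<close> is vertical, so naturality of the band moves
  a scalar across it unchanged. Conjugation by this component carries \<open>FArr F (b x s)\<close>
  to \<open>FArr F' (b x s)\<close>, and the two have the same scalar.\<close>

lemma induces_on_band_two_morphism:
  assumes F: "gerbe_endo Y P F" "gerbe_endo Y P F'" and \<eta>: "two_morphism C Y P F F' \<eta>"
    and \<phi>: "induces_on_band C A Y P b F \<phi>"
  shows "induces_on_band C A Y P b F' \<phi>"
proof -
  have "FArr F' (b x s) = b (FObj F' x) (\<phi> (FObj P x) s)"
    if x: "x \<in> Obj Y" and s: "s \<in> carrier (Sec A (FObj P x))" for x s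
  proof -
    note v = two_morphism_vertical[OF \<eta> F(1) x]
    note Fx = endo_Obj[OF F(1) x] endo_Obj[OF F(2) x]
    note Px = endo_FObj[OF F(1) x] endo_FObj[OF F(2) x]
    have c: "\<phi> (FObj P x) s \<in> carrier (Sec A (FObj P x))"
      using induces_on_band_section[OF \<phi> proj_Obj[OF x] s] by (simp add: induced_section_def)
    have p: "b x s \<in> Hom Y x x" using band_vertical[OF x s] vertical_Hom by blast
    have "FArr F' (b x s) \<odot> \<eta> x = \<eta> x \<odot> b (FObj F x) (\<phi> (FObj P x) s)"
      using two_morphism_natural[OF \<eta> p] \<phi> x s by (simp add: induces_on_band_def)
    also have "\<dots> = b (FObj F' x) (\<phi> (FObj P x) s) \<odot> \<eta> x"
      using band_natural[OF vertical_Hom[OF v], of "\<phi> (FObj P x) s"] vertical_FArr[OF v]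
        Px Res_Ide[OF proj_Obj[OF x] c] c by simp
    finally show ?thesis
      using vertical_right_cancel[OF v endo_Hom[OF F(2) p]] band_vertical[OF Fx(2)] vertical_Hom
        Px c by simp
  qed
  then show ?thesis using \<phi> by (simp add: induces_on_band_def)
qed

text \<open>Source of the strict product law of the underlying action: the 2-isomorphism disappears
  on the band.\<close>

lemma band_map_two_isomorphic_comp:
  assumes F: "gerbe_endo Y P F" "gerbe_endo Y P H" "gerbe_endo Y P K"
    and "two_isomorphic C Y P K (func_comp F H)" and U: "U \<in> Obj C" and s: "s \<in> carrier (Sec A U)"
  shows "band_map C A Y P b K U s = band_map C A Y P b F U (band_map C A Y P b H U s)"
proof -
  obtain \<eta> where \<eta>: "two_morphism C Y P K (func_comp F H) \<eta>"
    using assms(4) by (auto simp: two_isomorphic_def)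
  have FH: "gerbe_endo Y P (func_comp F H)" using gerbe_endo_comp F by blast
  have "band_map C A Y P b K U s = band_map C A Y P b (func_comp F H) U s"
    using band_map_eqI[OF FH induces_on_band_two_morphism[OF F(3) FH \<eta> induces_band_map[OF F(3)]] U s]
    by simp
  also have "\<dots> = band_map C A Y P b F U (band_map C A Y P b H U s)"
    using band_map_eqI[OF FH induces_on_band_comp[OF F(2) induces_band_map[OF F(1)] induces_band_map[OF F(2)]] U s] .
  finally show ?thesis .
qed

end

section \<open>Cohomology classes\<close>

locale G_module = group G + M: comm_group M
  for G :: "'g monoid" (structure) and M :: "'a monoid" and act :: "'g \<Rightarrow> 'a \<Rightarrow> 'a" +
  assumes act_hom: "g \<in> carrier G \<Longrightarrow> act g \<in> hom M M"
begin

lemma act_closed: "\<lbrakk>g \<in> carrier G; m \<in> carrier M\<rbrakk> \<Longrightarrow> act g m \<in> carrier M"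
  using act_hom hom_in_carrier by metis

lemma act_mult:
  "\<lbrakk>g \<in> carrier G; m \<in> carrier M; n \<in> carrier M\<rbrakk>
    \<Longrightarrow> act g (m \<otimes>\<^bsub>M\<^esub> n) = act g m \<otimes>\<^bsub>M\<^esub> act g n"
  using act_hom hom_mult by metis

lemma comm_group_cochain_group: "comm_group (cochain_group G M n)"
proof -
  have mem: "c gs \<in> carrier M" if "c \<in> tuples G n \<rightarrow>\<^sub>E carrier M" "gs \<in> tuples G n" for c gs
    using that by (rule PiE_mem)
  \<comment> \<open>Products of cochains are restricted functions; extensionality of
    \<open>c\<close> removes the restriction, also outside the tuples.\<close>
  have arb: "(if gs \<in> tuples G n then c gs else undefined) = c gs"
    if "c \<in> tuples G n \<rightarrow>\<^sub>E carrier M" for c gs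
    using PiE_arb[OF that] by simp
  show ?thesis
  proof (rule comm_groupI)
    fix c assume c: "c \<in> carrier (cochain_group G M n)"
    show "\<exists>d \<in> carrier (cochain_group G M n). d \<otimes>\<^bsub>cochain_group G M n\<^esub> c = \<one>\<^bsub>cochain_group G M n\<^esub>"
      by (rule bexI[of _ "\<lambda>gs \<in> tuples G n. inv\<^bsub>M\<^esub> c gs"])
        (use c in \<open>auto simp: cochain_group_def mem intro!: restrict_ext\<close>)
  qed (auto simp: cochain_group_def restrict_def fun_eq_iff mem arb M.m_ac)
qed

lemma merge_tuples:
  assumes "gs \<in> tuples G (Suc n)" "i < n" shows "merge G i gs \<in> tuples G n"
proof -
  have "gs ! i \<in> carrier G" "gs ! Suc i \<in> carrier G"
    using assms by (auto simp: tuples_def intro!: subsetD[OF _ nth_mem])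
  moreover have "set (take i gs) \<subseteq> carrier G" "set (drop (i + 2) gs) \<subseteq> carrier G"
    using assms set_take_subset[of i gs] set_drop_subset[of "i + 2" gs] by (auto simp: tuples_def)
  ultimately show ?thesis using assms by (auto simp: tuples_def merge_def)
qed

lemma hd_tuples: "gs \<in> tuples G (Suc n) \<Longrightarrow> hd gs \<in> carrier G"
  and tl_tuples: "gs \<in> tuples G (Suc n) \<Longrightarrow> tl gs \<in> tuples G n"
  and butlast_tuples: "gs \<in> tuples G (Suc n) \<Longrightarrow> butlast gs \<in> tuples G n"
  by (cases gs; auto simp: tuples_def dest: in_set_butlastD)+

text \<open>Commutativity of \<open>M\<close> lets powers and finite products distribute over a
  product of cochains. The purpose is that images of differentials are subgroups, so that cosets of
  coboundaries behave as classes.\<close>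

lemma differential_hom:
  "differential G M act n \<in> hom (cochain_group G M n) (cochain_group G M (Suc n))"
proof (rule homI)
  fix c assume c: "c \<in> carrier (cochain_group G M n)"
  then have "\<And>gs. gs \<in> tuples G n \<Longrightarrow> c gs \<in> carrier M" by (auto simp: cochain_group_def)
  then show "differential G M act n c \<in> carrier (cochain_group G M (Suc n))"
    by (auto simp: cochain_group_def differential_def hd_tuples tl_tuples butlast_tuples merge_tuples
        act_closed intro!: M.finprod_closed)
next
  fix c d assume "c \<in> carrier (cochain_group G M n)" "d \<in> carrier (cochain_group G M n)"
  then have c: "\<And>gs. gs \<in> tuples G n \<Longrightarrow> c gs \<in> carrier M"
    and d: "\<And>gs. gs \<in> tuples G n \<Longrightarrow> d gs \<in> carrier M" by (auto simp: cochain_group_def)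
  show "differential G M act n (c \<otimes>\<^bsub>cochain_group G M n\<^esub> d)
    = differential G M act n c \<otimes>\<^bsub>cochain_group G M (Suc n)\<^esub> differential G M act n d"
  proof (rule ext)
    fix gs
    show "differential G M act n (c \<otimes>\<^bsub>cochain_group G M n\<^esub> d) gs
      = (differential G M act n c \<otimes>\<^bsub>cochain_group G M (Suc n)\<^esub> differential G M act n d) gs"
    proof (cases "gs \<in> tuples G (Suc n)")
      case gs: True
      note mem = hd_tuples[OF gs] tl_tuples[OF gs] butlast_tuples[OF gs] merge_tuples[OF gs]
      let ?e = "\<lambda>i. (-1) ^ Suc i :: int"
      have "(\<Otimes>\<^bsub>M\<^esub>i\<in>{..<n}. (c (merge G i gs) \<otimes>\<^bsub>M\<^esub> d (merge G i gs)) [^]\<^bsub>M\<^esub> ?e i)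
        = (\<Otimes>\<^bsub>M\<^esub>i\<in>{..<n}. c (merge G i gs) [^]\<^bsub>M\<^esub> ?e i \<otimes>\<^bsub>M\<^esub> d (merge G i gs) [^]\<^bsub>M\<^esub> ?e i)"
        using c d mem by (intro M.finprod_cong') (auto intro!: M.int_pow_distrib)
      also have "\<dots> = (\<Otimes>\<^bsub>M\<^esub>i\<in>{..<n}. c (merge G i gs) [^]\<^bsub>M\<^esub> ?e i)
        \<otimes>\<^bsub>M\<^esub> (\<Otimes>\<^bsub>M\<^esub>i\<in>{..<n}. d (merge G i gs) [^]\<^bsub>M\<^esub> ?e i)"
        using c d mem by (intro M.finprod_multf) auto
      finally have p: "(\<Otimes>\<^bsub>M\<^esub>i\<in>{..<n}. (c (merge G i gs) \<otimes>\<^bsub>M\<^esub> d (merge G i gs)) [^]\<^bsub>M\<^esub> ?e i)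
        = (\<Otimes>\<^bsub>M\<^esub>i\<in>{..<n}. c (merge G i gs) [^]\<^bsub>M\<^esub> ?e i)
        \<otimes>\<^bsub>M\<^esub> (\<Otimes>\<^bsub>M\<^esub>i\<in>{..<n}. d (merge G i gs) [^]\<^bsub>M\<^esub> ?e i)" .
      \<comment> \<open>The product cochain is a restricted function; it can be evaluated on merged
        tuples because merging produces tuples of length \<open>n\<close> again.\<close>
      have q: "(\<Otimes>\<^bsub>M\<^esub>i\<in>{..<n}. (\<lambda>gs\<in>tuples G n. c gs \<otimes>\<^bsub>M\<^esub> d gs) (merge G i gs) [^]\<^bsub>M\<^esub> ?e i)
        = (\<Otimes>\<^bsub>M\<^esub>i\<in>{..<n}. (c (merge G i gs) \<otimes>\<^bsub>M\<^esub> d (merge G i gs)) [^]\<^bsub>M\<^esub> ?e i)"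
        using c d mem by (intro M.finprod_cong') auto
      have cl: "(\<Otimes>\<^bsub>M\<^esub>i\<in>{..<n}. c (merge G i gs) [^]\<^bsub>M\<^esub> ?e i) \<in> carrier M"
        "(\<Otimes>\<^bsub>M\<^esub>i\<in>{..<n}. d (merge G i gs) [^]\<^bsub>M\<^esub> ?e i) \<in> carrier M"
        "c (butlast gs) [^]\<^bsub>M\<^esub> ?e n \<in> carrier M" "d (butlast gs) [^]\<^bsub>M\<^esub> ?e n \<in> carrier M"
        "act (hd gs) (c (tl gs)) \<in> carrier M" "act (hd gs) (d (tl gs)) \<in> carrier M"
        using c d mem act_closed by (auto intro!: M.finprod_closed)
      have "differential G M act n (c \<otimes>\<^bsub>cochain_group G M n\<^esub> d) gs
        = act (hd gs) (c (tl gs) \<otimes>\<^bsub>M\<^esub> d (tl gs))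
          \<otimes>\<^bsub>M\<^esub> ((\<Otimes>\<^bsub>M\<^esub>i\<in>{..<n}. c (merge G i gs) [^]\<^bsub>M\<^esub> ?e i)
            \<otimes>\<^bsub>M\<^esub> (\<Otimes>\<^bsub>M\<^esub>i\<in>{..<n}. d (merge G i gs) [^]\<^bsub>M\<^esub> ?e i))
          \<otimes>\<^bsub>M\<^esub> (c (butlast gs) \<otimes>\<^bsub>M\<^esub> d (butlast gs)) [^]\<^bsub>M\<^esub> ?e n"
        using gs mem q p unfolding differential_def cochain_group_def by (simp only: restrict_apply if_True monoid.select_convs)
      also have "\<dots> = (act (hd gs) (c (tl gs)) \<otimes>\<^bsub>M\<^esub> act (hd gs) (d (tl gs)))
          \<otimes>\<^bsub>M\<^esub> ((\<Otimes>\<^bsub>M\<^esub>i\<in>{..<n}. c (merge G i gs) [^]\<^bsub>M\<^esub> ?e i)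
            \<otimes>\<^bsub>M\<^esub> (\<Otimes>\<^bsub>M\<^esub>i\<in>{..<n}. d (merge G i gs) [^]\<^bsub>M\<^esub> ?e i))
          \<otimes>\<^bsub>M\<^esub> (c (butlast gs) [^]\<^bsub>M\<^esub> ?e n \<otimes>\<^bsub>M\<^esub> d (butlast gs) [^]\<^bsub>M\<^esub> ?e n)"
        using c d mem by (simp only: act_mult M.int_pow_distrib)
      also have "\<dots> = differential G M act n c gs \<otimes>\<^bsub>M\<^esub> differential G M act n d gs"
        using cl gs by (simp only: differential_def restrict_apply if_True M.m_ac M.m_closed)
      finally show ?thesis using gs by (simp add: cochain_group_def)
    qed (simp add: differential_def cochain_group_def)
  qed
qed

lemma coboundaries_subgroup: "subgroup (coboundaries G M act n) (cochain_group G M n)"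
proof (cases n)
  case 0
  interpret K: comm_group "cochain_group G M 0" by (rule comm_group_cochain_group)
  show ?thesis using K.triv_subgroup 0 by simp
next
  case (Suc k)
  have "group_hom (cochain_group G M k) (cochain_group G M (Suc k)) (differential G M act k)"
    using comm_group_cochain_group[THEN comm_group.axioms(2)] differential_hom
    by (auto simp: group_hom_def group_hom_axioms_def)
  then show ?thesis using group_hom.img_is_subgroup Suc by force
qed

text \<open>A coset depends only on the multiplication, and \<open>cocycle_group\<close> changes
  only the carrier of \<open>cochain_group\<close>; absorbing \<open>h\<close> can therefore be
  computed in the full cochain group.\<close>

lemma cohomology_class_coboundary:
  assumes h: "h \<in> coboundaries G M act n" and c: "c \<in> carrier (cochain_group G M n)"
  shows "cohomology_class G M act n (h \<otimes>\<^bsub>cochain_group G M n\<^esub> c) = cohomology_class G M act n c"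
proof -
  interpret K: comm_group "cochain_group G M n" by (rule comm_group_cochain_group)
  note B = coboundaries_subgroup[of n]
  have hc: "h \<in> carrier (cochain_group G M n)" using subgroup.mem_carrier[OF B h] .
  have "coboundaries G M act n #>\<^bsub>cochain_group G M n\<^esub> (h \<otimes>\<^bsub>cochain_group G M n\<^esub> c)
    = coboundaries G M act n #>\<^bsub>cochain_group G M n\<^esub> c"
    using K.coset_mult_assoc[OF subgroup.subset[OF B] hc c] K.coset_join2[OF hc B h] by simp
  then show ?thesis by (simp add: cohomology_class_def cocycle_group_def r_coset_def)
qed

lemma cohomology_class_in_cohomology:
  "c \<in> cocycles G M act n \<Longrightarrow> cohomology_class G M act n c \<in> carrier (cohomology G M act n)"
  by (auto simp: cohomology_def FactGroup_def RCOSETS_def cohomology_class_def cocycle_group_def)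

text \<open>The inner bracket is the product over \<open>merge\<close>, whose exponents alternate
  starting with -1. The exponent of the last factor is -1 here and +1 in
  \<open>differential_3\<close>.\<close>

lemma differential_2:
  assumes c: "c \<in> carrier (cochain_group G M 2)"
    and g: "g \<in> carrier G" "h \<in> carrier G" "k \<in> carrier G"
  shows "differential G M act 2 c [g, h, k] =
    act g (c [h, k]) \<otimes>\<^bsub>M\<^esub> (inv\<^bsub>M\<^esub> c [g \<otimes> h, k] \<otimes>\<^bsub>M\<^esub> c [g, h \<otimes> k]) \<otimes>\<^bsub>M\<^esub> inv\<^bsub>M\<^esub> c [g, h]"
proof -
  have "\<And>x y. \<lbrakk>x \<in> carrier G; y \<in> carrier G\<rbrakk> \<Longrightarrow> c [x, y] \<in> carrier M"
    using c by (auto simp: cochain_group_def tuples_def)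
  then show ?thesis
    using g by (simp add: differential_def tuples_def merge_def numeral_2_eq_2 lessThan_Suc
        M.int_pow_neg M.m_comm act_closed)
qed

lemma differential_3:
  assumes c: "c \<in> carrier (cochain_group G M 3)"
    and g: "g \<in> carrier G" "h \<in> carrier G" "k \<in> carrier G" "l \<in> carrier G"
  shows "differential G M act 3 c [g, h, k, l] =
    act g (c [h, k, l]) \<otimes>\<^bsub>M\<^esub> (inv\<^bsub>M\<^esub> c [g \<otimes> h, k, l] \<otimes>\<^bsub>M\<^esub> c [g, h \<otimes> k, l] \<otimes>\<^bsub>M\<^esub> inv\<^bsub>M\<^esub> c [g, h, k \<otimes> l])
      \<otimes>\<^bsub>M\<^esub> c [g, h, k]"
proof -
  have "\<And>x y z. \<lbrakk>x \<in> carrier G; y \<in> carrier G; z \<in> carrier G\<rbrakk> \<Longrightarrow> c [x, y, z] \<in> carrier M"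
    using c by (auto simp: cochain_group_def tuples_def)
  then show ?thesis
    using g by (simp add: differential_def tuples_def merge_def numeral_3_eq_3 numeral_2_eq_2 lessThan_Suc
        M.int_pow_neg M.m_ac act_closed)
qed

lemma tuples_3E:
  assumes "gs \<in> tuples G 3"
  obtains g h k where "gs = [g, h, k]" "g \<in> carrier G" "h \<in> carrier G" "k \<in> carrier G"
  using assms by (auto simp: tuples_def numeral_3_eq_3 length_Suc_conv)

lemma tuples_4E:
  assumes "gs \<in> tuples G 4"
  obtains g h k l where "gs = [g, h, k, l]"
    "g \<in> carrier G" "h \<in> carrier G" "k \<in> carrier G" "l \<in> carrier G"
  using assms by (auto simp: tuples_def eval_nat_numeral length_Suc_conv)

end

section \<open>Global sections acting on arrows\<close>

locale banded_gerbe_final = banded_gerbe C J A Y P b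
  for C :: "('o, 'm) category" and J and A :: "('o, 'm, 'a) presheaf"
    and Y :: "('p, 'q) category" and P :: "('p, 'q, 'o, 'm) functor_data"
    and b :: "'p \<Rightarrow> 'a \<Rightarrow> 'q" +
  fixes X :: 'o
  assumes final: "final_object C X"
begin

definition global_res :: "'p \<Rightarrow> 'a \<Rightarrow> 'a" where
  "global_res x s = Res A (to_final C X (FObj P x)) s"

text \<open>Reading the scalar at \<open>Tgt Y \<phi>\<close> makes this a function of the arrow
  alone; \<open>scale_eq_right\<close> shows that acting at the source gives the same
  result.\<close>

definition scale :: "'a \<Rightarrow> 'q \<Rightarrow> 'q" (infixr "\<bullet>" 72) where
  "s \<bullet> \<phi> = b (Tgt Y \<phi>) (global_res (Tgt Y \<phi>) s) \<odot> \<phi>"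

section \<open>Global sections and their restrictions to objects\<close>

lemma X_Obj: "X \<in> Obj C"
  using final by (simp add: final_object_def)

lemma to_final_eq: "f \<in> Hom C U X \<Longrightarrow> to_final C X U = f"
proof -
  assume f: "f \<in> Hom C U X"
  then have "\<exists>!f. f \<in> Hom C U X"
    using final Src_Obj by (auto simp: final_object_def Hom_def)
  then show ?thesis unfolding to_final_def using f by (rule the1_equality)
qed

lemma to_final_Hom: "U \<in> Obj C \<Longrightarrow> to_final C X U \<in> Hom C U X"
  using final to_final_eq unfolding final_object_def by blast

lemma global_res_carrier:
  "\<lbrakk>x \<in> Obj Y; s \<in> carrier (Sec A X)\<rbrakk> \<Longrightarrow> global_res x s \<in> carrier (Sec A (FObj P x))"
  unfolding global_res_def using Res_carrier to_final_Hom proj_Obj by blast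

lemma Res_global_res:
  assumes \<phi>: "\<phi> \<in> Hom Y y x" and s: "s \<in> carrier (Sec A X)"
  shows "Res A (FArr P \<phi>) (global_res x s) = global_res y s"
proof -
  have f: "to_final C X (FObj P x) \<in> Hom C (FObj P x) X"
    using to_final_Hom proj_Obj Hom_Obj \<phi> by blast
  show ?thesis
    unfolding global_res_def
    using Res_Cmp[OF f proj_Hom[OF \<phi>] s] to_final_eq[OF Cmp_Hom[OF f proj_Hom[OF \<phi>]]] by simp
qed

text \<open>Every base has exactly one arrow to the final object, so the families of
  \<open>glue_over_objects\<close> lose their dependence on \<open>f\<close>.\<close>

lemma ex1_global_section:
  assumes tc: "\<And>x. x \<in> Obj Y \<Longrightarrow> t x \<in> carrier (Sec A (FObj P x))"
    and tn: "\<And>x y \<phi>. \<phi> \<in> Hom Y y x \<Longrightarrow> t y = Res A (FArr P \<phi>) (t x)"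
  shows "\<exists>!s. s \<in> carrier (Sec A X) \<and> (\<forall>x \<in> Obj Y. global_res x s = t x)"
proof -
  have "\<exists>!s. s \<in> carrier (Sec A X) \<and> (\<forall>x \<in> Obj Y. \<forall>f \<in> Hom C (FObj P x) X. Res A f s = t x)"
    using glue_over_objects[OF abelian_sheaf_axioms X_Obj, of "\<lambda>f x. t x"] tc tn by blast
  moreover have "(\<forall>f \<in> Hom C (FObj P x) X. Res A f s = t x) \<longleftrightarrow> global_res x s = t x"
    if "x \<in> Obj Y" for x s
    unfolding global_res_def using to_final_eq to_final_Hom[OF proj_Obj[OF that]] by blast
  ultimately show ?thesis by simp
qed

text \<open>The restrictions of \<open>t\<close> to the objects form a compatible family, and both
  sections glue it.\<close>

lemma global_section_eqI:
  assumes "s \<in> carrier (Sec A X)" "t \<in> carrier (Sec A X)"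
    and "\<And>x. x \<in> Obj Y \<Longrightarrow> global_res x s = global_res x t"
  shows "s = t"
proof -
  have "\<exists>!s. s \<in> carrier (Sec A X) \<and> (\<forall>x \<in> Obj Y. global_res x s = global_res x t)"
    using global_res_carrier[OF _ assms(2)] Res_global_res[OF _ assms(2)]
    by (intro ex1_global_section) simp_all
  with assms show ?thesis by blast
qed

section \<open>The scaling action on arrows\<close>

lemma scale_eq:
  assumes "\<phi> \<in> Hom Y x y" shows "s \<bullet> \<phi> = b y (global_res y s) \<odot> \<phi>"
  using assms by (simp add: scale_def Hom_def)

lemma band_global_Hom:
  "\<lbrakk>x \<in> Obj Y; s \<in> carrier (Sec A X)\<rbrakk> \<Longrightarrow> b x (global_res x s) \<in> Hom Y x x"
  using band_vertical global_res_carrier vertical_Hom by blast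

lemma scale_Hom: "\<lbrakk>\<phi> \<in> Hom Y x y; s \<in> carrier (Sec A X)\<rbrakk> \<Longrightarrow> s \<bullet> \<phi> \<in> Hom Y x y"
  using Y.Cmp_Hom[OF band_global_Hom[OF Hom_Obj(2)]] scale_eq by simp

text \<open>Naturality of the band moves the scalar across \<phi>, restricting it along the base
  arrow; uniqueness of arrows to \<open>X\<close> makes that restriction the same global section
  seen at \<open>x\<close>.\<close>

lemma scale_eq_right:
  assumes \<phi>: "\<phi> \<in> Hom Y x y" and s: "s \<in> carrier (Sec A X)"
  shows "s \<bullet> \<phi> = \<phi> \<odot> b x (global_res x s)"
  using band_natural[OF \<phi> global_res_carrier[OF Hom_Obj(2)[OF \<phi>] s]] Res_global_res[OF \<phi> s]
    scale_eq[OF \<phi>] by simp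

lemma scale_Cmp_left:
  assumes "\<phi> \<in> Hom Y y z" "\<psi> \<in> Hom Y x y" "s \<in> carrier (Sec A X)"
  shows "(s \<bullet> \<phi>) \<odot> \<psi> = s \<bullet> (\<phi> \<odot> \<psi>)"
  using Y.Cmp_assoc[OF band_global_Hom[OF Hom_Obj(2)[OF assms(1)] assms(3)] assms(1,2)]
    scale_eq[OF assms(1)] scale_eq[OF Y.Cmp_Hom[OF assms(1,2)]] by simp

lemma scale_Cmp_right:
  assumes "\<phi> \<in> Hom Y y z" "\<psi> \<in> Hom Y x y" "s \<in> carrier (Sec A X)"
  shows "\<phi> \<odot> (s \<bullet> \<psi>) = s \<bullet> (\<phi> \<odot> \<psi>)"
  using Y.Cmp_assoc[OF assms(1,2) band_global_Hom[OF Hom_Obj(1)[OF assms(2)] assms(3)]]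
    scale_eq_right[OF assms(2,3)] scale_eq_right[OF Y.Cmp_Hom[OF assms(1,2)] assms(3)] by simp

lemma scale_mult:
  assumes \<phi>: "\<phi> \<in> Hom Y x y" and s: "s \<in> carrier (Sec A X)" and t: "t \<in> carrier (Sec A X)"
  shows "(s \<otimes>\<^bsub>Sec A X\<^esub> t) \<bullet> \<phi> = s \<bullet> t \<bullet> \<phi>"
proof -
  have y: "y \<in> Obj Y" using Hom_Obj \<phi> by blast
  have "global_res y (s \<otimes>\<^bsub>Sec A X\<^esub> t) = global_res y s \<otimes>\<^bsub>Sec A (FObj P y)\<^esub> global_res y t"
    unfolding global_res_def using hom_mult[OF Res_hom[OF to_final_Hom[OF proj_Obj[OF y]]] s t] .
  then have "(s \<otimes>\<^bsub>Sec A X\<^esub> t) \<bullet> \<phi> = b y (global_res y s) \<odot> b y (global_res y t) \<odot> \<phi>"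
    using scale_eq[OF \<phi>] band_mult[OF y global_res_carrier[OF y s] global_res_carrier[OF y t]] by simp
  also have "\<dots> = s \<bullet> t \<bullet> \<phi>"
    using Y.Cmp_assoc[OF band_global_Hom[OF y s] band_global_Hom[OF y t] \<phi>]
      scale_eq[OF \<phi>] scale_eq[OF scale_Hom[OF \<phi> t]] by simp
  finally show ?thesis .
qed

text \<open>Semilinearity of \<open>F\<close>. This is what produces the factor \<open>act g\<close>
  in the cocycle and coboundary formulas.\<close>

lemma FArr_scale:
  assumes F: "gerbe_endo Y P F" and \<phi>: "\<phi> \<in> Hom Y x y" and s: "s \<in> carrier (Sec A X)"
  shows "FArr F (s \<bullet> \<phi>) = band_map C A Y P b F X s \<bullet> FArr F \<phi>"
proof -
  have y: "y \<in> Obj Y" using Hom_Obj \<phi> by blast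
  have "FArr F (b y (global_res y s)) = b (FObj F y) (global_res (FObj F y) (band_map C A Y P b F X s))"
    using FArr_band[OF F y global_res_carrier[OF y s]] band_map_Res[OF F to_final_Hom[OF proj_Obj[OF y]] s]
      endo_FObj[OF F y] by (simp add: global_res_def)
  then show ?thesis
    using endo_Cmp[OF F \<phi> band_global_Hom[OF y s]] scale_eq[OF \<phi>] scale_eq[OF endo_Hom[OF F \<phi>]] by simp
qed

lemma scale_inj:
  assumes \<phi>: "\<phi> \<in> Hom Y x y" and s: "s \<in> carrier (Sec A X)" and t: "t \<in> carrier (Sec A X)"
    and eq: "s \<bullet> \<phi> = t \<bullet> \<phi>"
  shows "global_res x s = global_res x t"
proof -
  have x: "x \<in> Obj Y" using Hom_Obj \<phi> by blast
  note v = band_vertical[OF x global_res_carrier[OF x s]] band_vertical[OF x global_res_carrier[OF x t]]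
  have "b x (global_res x s) = b x (global_res x t)"
    using left_cancel[OF \<phi> v[THEN vertical_Hom]] v[THEN vertical_FArr] eq
      scale_eq_right[OF \<phi> s] scale_eq_right[OF \<phi> t] by simp
  then show ?thesis using band_inj[OF x] global_res_carrier x s t by blast
qed

text \<open>Cancelling the test arrow gives equality of the scalars at \<open>FObj F x\<close>,
  which lies over the same base as \<open>x\<close>; all objects together determine the global
  section.\<close>

lemma scale_eqI:
  assumes F: "gerbe_endo Y P F" and s: "s \<in> carrier (Sec A X)" and t: "t \<in> carrier (Sec A X)"
    and \<phi>: "\<And>x. x \<in> Obj Y \<Longrightarrow> \<phi> x \<in> Hom Y (FObj F x) (y x)"
    and eq: "\<And>x. x \<in> Obj Y \<Longrightarrow> s \<bullet> \<phi> x = t \<bullet> \<phi> x"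
  shows "s = t"
proof (rule global_section_eqI[OF s t])
  fix x assume x: "x \<in> Obj Y"
  show "global_res x s = global_res x t"
    using scale_inj[OF \<phi>[OF x] s t eq[OF x]] endo_FObj[OF F x] by (simp add: global_res_def)
qed

text \<open>The torsor property: over each \<open>x\<close> the two components differ by an
  automorphism of \<open>FObj F x\<close>, that is by a local scalar, and naturality of both
  2-morphisms lets these scalars glue.\<close>

lemma ex1_scale_two_morphism:
  assumes F: "gerbe_endo Y P F" "gerbe_endo Y P F'"
    and \<eta>: "two_morphism C Y P F F' \<eta>" and \<theta>: "two_morphism C Y P F F' \<theta>"
  shows "\<exists>!s. s \<in> carrier (Sec A X) \<and> (\<forall>x \<in> Obj Y. s \<bullet> \<eta> x = \<theta> x)"
proof (rule ex_ex1I)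
  note \<eta>v = two_morphism_vertical[OF \<eta> F(1)] and \<theta>v = two_morphism_vertical[OF \<theta> F(1)]
  note \<eta>H = \<eta>v[THEN vertical_Hom] and \<theta>H = \<theta>v[THEN vertical_Hom]
  \<comment> \<open>The scalar of the automorphism obtained by applying \<theta> at \<open>x\<close>
    and then the inverse of \<eta> at \<open>x\<close>.\<close>
  define t where "t x = (SOME r. r \<in> carrier (Sec A (FObj P x)) \<and> \<eta> x \<odot> b (FObj F x) r = \<theta> x)" for x
  have t: "t x \<in> carrier (Sec A (FObj P x)) \<and> \<eta> x \<odot> b (FObj F x) (t x) = \<theta> x" if x: "x \<in> Obj Y" for x
  proof -
    obtain \<psi> where \<psi>: "\<psi> \<in> vertical (FObj F' x) (FObj F x)" "\<eta> x \<odot> \<psi> = Ide Y (FObj F' x)"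
      by (rule vertical_inverse[OF \<eta>v[OF x]])
    obtain r where r: "r \<in> carrier (Sec A (FObj P x))" "b (FObj F x) r = \<psi> \<odot> \<theta> x"
      using band_surj[OF endo_Obj[OF F(1) x] vertical_Cmp[OF \<theta>v[OF x] \<psi>(1)]] endo_FObj[OF F(1) x] by auto
    have "\<eta> x \<odot> b (FObj F x) r = \<theta> x"
      using Y.Cmp_assoc[OF \<eta>H[OF x] vertical_Hom[OF \<psi>(1)] \<theta>H[OF x]] r(2) \<psi>(2) Y.Ide_left[OF \<theta>H[OF x]]
      by simp
    with r(1) have "\<exists>r. r \<in> carrier (Sec A (FObj P x)) \<and> \<eta> x \<odot> b (FObj F x) r = \<theta> x" by blast
    then show ?thesis unfolding t_def by (rule someI_ex)
  qed
  have nat: "t y = Res A (FArr P \<phi>) (t x)" if \<phi>: "\<phi> \<in> Hom Y y x" for x y \<phi>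
  proof -
    have x: "x \<in> Obj Y" and y: "y \<in> Obj Y" using Hom_Obj \<phi> by auto
    note Fx = endo_Obj[OF F(1) x] and Fy = endo_Obj[OF F(1) y]
    note Px = endo_FObj[OF F(1) x] and Py = endo_FObj[OF F(1) y]
    note F\<phi> = endo_Hom[OF F(1) \<phi>] and F'\<phi> = endo_Hom[OF F(2) \<phi>]
    let ?r = "Res A (FArr P \<phi>) (t x)"
    have r: "?r \<in> carrier (Sec A (FObj P y))"
      using Res_carrier[OF proj_Hom[OF \<phi>]] t[OF x] by blast
    have v: "b (FObj F y) (t y) \<in> vertical (FObj F y) (FObj F y)"
      "b (FObj F y) ?r \<in> vertical (FObj F y) (FObj F y)"
      "b (FObj F x) (t x) \<in> vertical (FObj F x) (FObj F x)"
      using band_vertical[OF Fy, unfolded Py] band_vertical[OF Fx, unfolded Px]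
        conjunct1[OF t[OF y]] conjunct1[OF t[OF x]] r Px Py by simp_all
    note vH = v[THEN vertical_Hom]
    \<comment> \<open>The two scalars at \<open>y\<close> are compared after composing with
      \<open>FArr F' \<phi> \<odot> \<eta> y\<close>; by naturality of \<eta> and \<theta> both
      composites equal \<open>\<theta> x \<odot> FArr F \<phi>\<close>.\<close>
    have "FArr F' \<phi> \<odot> \<eta> y \<odot> b (FObj F y) (t y) = FArr F' \<phi> \<odot> \<theta> y"
      using Y.Cmp_assoc[OF F'\<phi> \<eta>H[OF y] vH(1)] t[OF y] by simp
    also have "\<dots> = \<theta> x \<odot> FArr F \<phi>" using two_morphism_natural[OF \<theta> \<phi>] by simp
    also have "\<dots> = \<eta> x \<odot> (b (FObj F x) (t x) \<odot> FArr F \<phi>)"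
      using Y.Cmp_assoc[OF \<eta>H[OF x] vH(3) F\<phi>] t[OF x] by simp
    also have "\<dots> = \<eta> x \<odot> (FArr F \<phi> \<odot> b (FObj F y) ?r)"
      using band_natural[OF F\<phi>, of "t x"] t[OF x] Px endo_FArr[OF F(1) \<phi>] by simp
    also have "\<dots> = FArr F' \<phi> \<odot> \<eta> y \<odot> b (FObj F y) ?r"
      using Y.Cmp_assoc[OF \<eta>H[OF x] F\<phi> vH(2)] two_morphism_natural[OF \<eta> \<phi>] by simp
    finally have "b (FObj F y) (t y) = b (FObj F y) ?r"
      using left_cancel[OF Y.Cmp_Hom[OF F'\<phi> \<eta>H[OF y]] vH(1,2)] v[THEN vertical_FArr] by simp
    then show ?thesis using band_inj[OF Fy, unfolded Py] conjunct1[OF t[OF y]] r by blast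
  qed
  obtain s where s: "s \<in> carrier (Sec A X)" "\<And>x. x \<in> Obj Y \<Longrightarrow> global_res x s = t x"
    using ex1_global_section[of t] t nat by blast
  have "s \<bullet> \<eta> x = \<theta> x" if x: "x \<in> Obj Y" for x
    using scale_eq_right[OF \<eta>H[OF x] s(1)] s(2)[OF x] t[OF x] endo_FObj[OF F(1) x]
    by (simp add: global_res_def)
  with s(1) show "\<exists>s. s \<in> carrier (Sec A X) \<and> (\<forall>x \<in> Obj Y. s \<bullet> \<eta> x = \<theta> x)" by blast
next
  fix s t assume st: "s \<in> carrier (Sec A X) \<and> (\<forall>x \<in> Obj Y. s \<bullet> \<eta> x = \<theta> x)"
    "t \<in> carrier (Sec A X) \<and> (\<forall>x \<in> Obj Y. t \<bullet> \<eta> x = \<theta> x)"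
  show "s = t"
    using st by (intro scale_eqI[OF F(1) _ _ two_morphism_vertical[OF \<eta> F(1), THEN vertical_Hom]]) auto
qed

text \<open>Here \<open>k1, \<dots>, k5\<close> are the scalars by which the faces of the associativity pentagon fail to
  commute; the face \<open>e5\<close> is the naturality square, which commutes strictly.\<close>

lemma scalar_pentagon:
  assumes H: "p \<in> Hom Y x2 x3" "q \<in> Hom Y x1 x2" "r \<in> Hom Y x0 x1" "u \<in> Hom Y x4 x3"
    "v \<in> Hom Y x1 x4" "w \<in> Hom Y x5 x4" "z \<in> Hom Y x0 x5" "t \<in> Hom Y x7 x3" "o' \<in> Hom Y x5 x7"
    "n \<in> Hom Y x6 x2" "m \<in> Hom Y x0 x6" "l \<in> Hom Y x6 x7"
    and k: "k1 \<in> carrier (Sec A X)" "k2 \<in> carrier (Sec A X)" "k3 \<in> carrier (Sec A X)"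
      "k4 \<in> carrier (Sec A X)" "k5 \<in> carrier (Sec A X)"
    and e1: "k1 \<bullet> (p \<odot> q) = u \<odot> v" and e2: "k2 \<bullet> (v \<odot> r) = w \<odot> z" and e3: "k3 \<bullet> (u \<odot> w) = t \<odot> o'"
    and e4: "k4 \<bullet> (q \<odot> r) = n \<odot> m" and e5: "p \<odot> n = t \<odot> l" and e6: "k5 \<bullet> (l \<odot> m) = o' \<odot> z"
  shows "(k3 \<otimes>\<^bsub>Sec A X\<^esub> (k2 \<otimes>\<^bsub>Sec A X\<^esub> k1)) \<bullet> (p \<odot> (q \<odot> r)) = (k5 \<otimes>\<^bsub>Sec A X\<^esub> k4) \<bullet> (p \<odot> (q \<odot> r))"
proof -
  interpret M: comm_group "Sec A X" using Sec_comm_group X_Obj .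
  note c = Y.Cmp_Hom and a = Y.Cmp_assoc
  have W: "p \<odot> (q \<odot> r) \<in> Hom Y x0 x3" using c[OF H(1) c[OF H(2,3)]] .
  \<comment> \<open>One way around: the faces \<open>e1\<close>, \<open>e2\<close>,
    \<open>e3\<close> turn the scaled path \<open>p\<close>, \<open>q\<close>, \<open>r\<close> into
    \<open>t\<close>, \<open>o'\<close>, \<open>z\<close>.\<close>
  have "k1 \<bullet> (p \<odot> (q \<odot> r)) = u \<odot> (v \<odot> r)"
    using a[OF H(1-3)] a[OF H(4,5,3)] scale_Cmp_left[OF c[OF H(1,2)] H(3) k(1)] e1 by simp
  then have "k2 \<bullet> k1 \<bullet> (p \<odot> (q \<odot> r)) = u \<odot> (w \<odot> z)"
    using scale_Cmp_right[OF H(4) c[OF H(5,3)] k(2)] e2 by simp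
  then have "k3 \<bullet> k2 \<bullet> k1 \<bullet> (p \<odot> (q \<odot> r)) = t \<odot> o' \<odot> z"
    using a[OF H(4,6,7)] scale_Cmp_left[OF c[OF H(4,6)] H(7) k(3)] e3 by simp
  \<comment> \<open>The other way around, between the same two paths, passes through
    \<open>e4\<close>, the strict square \<open>e5\<close>, and \<open>e6\<close>.\<close>
  moreover have "k4 \<bullet> (p \<odot> (q \<odot> r)) = t \<odot> (l \<odot> m)"
    using scale_Cmp_right[OF H(1) c[OF H(2,3)] k(4)] e4 a[OF H(1,10,11)] e5 a[OF H(8,12,11)] by simp
  then have "k5 \<bullet> k4 \<bullet> (p \<odot> (q \<odot> r)) = t \<odot> o' \<odot> z"
    using scale_Cmp_right[OF H(8) c[OF H(12,11)] k(5)] e6 a[OF H(8,9,7)] by simp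
  ultimately show ?thesis
    using scale_mult[OF W] scale_mult[OF scale_Hom[OF W]] k by simp
qed

end

section \<open>The obstruction cocycle\<close>

lemma the_eq_iff: "\<exists>!x. Q x \<Longrightarrow> (THE x. Q x) = a \<longleftrightarrow> Q a"
  by (metis theI')

text \<open>The connecting 2-morphisms are left as a parameter of the lemmas because two choices of
  them have to be compared.\<close>

locale gerbe_with_action = banded_gerbe_final C J A Y P b X + group G
  for C :: "('o, 'm) category" and J and A :: "('o, 'm, 'a) presheaf"
    and Y :: "('p, 'q) category" and P :: "('p, 'q, 'o, 'm) functor_data"
    and b :: "'p \<Rightarrow> 'a \<Rightarrow> 'q" and X :: 'o and G :: "'g monoid" (structure) +
  fixes F :: "'g \<Rightarrow> ('p, 'q) endo"
  assumes action: "gerbe_action C A Y P b G F"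
begin

abbreviation act :: "'g \<Rightarrow> 'a \<Rightarrow> 'a" where
  "act \<equiv> underlying_action C X A Y P b F"

lemma F_endo: "g \<in> carrier G \<Longrightarrow> gerbe_endo Y P (F g)"
  using action by (simp add: gerbe_action_def)

text \<open>The unit law is the condition on \<open>F \<one>\<close>; the product law comes from the
  2-isomorphisms in the action.\<close>

lemma G_module_sections: "is_G_module G (Sec A X) act"
  unfolding is_G_module_def underlying_action_def
  using Sec_comm_group[OF X_Obj] band_map_hom[OF F_endo X_Obj] action X_Obj
    band_map_two_isomorphic_comp[OF F_endo F_endo F_endo _ X_Obj]
  by (auto simp: gerbe_action_def)

sublocale G_module G "Sec A X" act
  using G_module_sections group_axioms
  by (auto simp: G_module_def G_module_axioms_def is_G_module_def)

section \<open>The scalar measuring failure of associativity\<close>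

lemma connecting_two_morphism:
  "\<lbrakk>connecting C Y P G F \<alpha>; g \<in> carrier G; h \<in> carrier G\<rbrakk>
    \<Longrightarrow> two_morphism C Y P (F (g \<otimes> h)) (func_comp (F g) (F h)) (\<alpha> g h)"
  by (simp add: connecting_def)

lemma connecting_Hom:
  assumes "connecting C Y P G F \<alpha>" "g \<in> carrier G" "h \<in> carrier G" "x \<in> Obj Y"
  shows "\<alpha> g h x \<in> Hom Y (FObj (F (g \<otimes> h)) x) (FObj (F g) (FObj (F h) x))"
  using two_morphism_vertical[OF connecting_two_morphism[OF assms(1-3)] F_endo assms(4)] assms
    vertical_Hom by simp

lemma ex1_kappa_value:
  assumes \<alpha>: "connecting C Y P G F \<alpha>" and g: "g1 \<in> carrier G" "g2 \<in> carrier G" "g3 \<in> carrier G"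
  shows "\<exists>!s. s \<in> carrier (Sec A X) \<and> (\<forall>x \<in> Obj Y.
    s \<bullet> (\<alpha> g1 g2 (FObj (F g3) x) \<odot> \<alpha> (g1 \<otimes> g2) g3 x)
      = FArr (F g1) (\<alpha> g2 g3 x) \<odot> \<alpha> g1 (g2 \<otimes> g3) x)"
proof -
  let ?H = "func_comp (F g1) (func_comp (F g2) (F g3))"
  have g': "g1 \<otimes> g2 \<in> carrier G" "g2 \<otimes> g3 \<in> carrier G" "g1 \<otimes> g2 \<otimes> g3 \<in> carrier G" using g by auto
  note E = F_endo gerbe_endo_comp[OF F_endo F_endo] and T = connecting_two_morphism[OF \<alpha>]
  have H: "gerbe_endo Y P ?H" using gerbe_endo_comp[OF E(1)[OF g(1)] E(2)[OF g(2,3)]] .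
  \<comment> \<open>Composition of functor data is strictly associative, so both paths end at the
    same \<open>?H\<close>.\<close>
  have "two_morphism C Y P (func_comp (F (g1 \<otimes> g2)) (F g3)) ?H (whisker_right (\<alpha> g1 g2) (F g3))"
    using two_morphism_whisker_right[OF E(1)[OF g(3)] T[OF g(1,2)]] by (simp add: func_comp_def comp_assoc)
  then have "two_morphism C Y P (F (g1 \<otimes> g2 \<otimes> g3)) ?H
      (vcomp Y (whisker_right (\<alpha> g1 g2) (F g3)) (\<alpha> (g1 \<otimes> g2) g3))"
    by (rule two_morphism_vcomp[OF E(1)[OF g'(3)] E(2)[OF g'(1) g(3)] H T[OF g'(1) g(3)]])
  \<comment> \<open>Associativity of \<open>G\<close> gives the second path the same source as the
    first.\<close>
  moreover have "two_morphism C Y P (F (g1 \<otimes> g2 \<otimes> g3)) ?H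
      (vcomp Y (whisker_left (F g1) (\<alpha> g2 g3)) (\<alpha> g1 (g2 \<otimes> g3)))"
    using two_morphism_vcomp[OF E(1)[OF g'(3)] E(2)[OF g(1) g'(2)] H _
        two_morphism_whisker_left[OF E(1)[OF g(1)] E(1)[OF g'(2)] E(2)[OF g(2,3)] T[OF g(2,3)]]]
      T[OF g(1) g'(2)] g by (simp add: m_assoc)
  ultimately show ?thesis
    using ex1_scale_two_morphism[OF E(1)[OF g'(3)] H]
    by (simp add: vcomp_def whisker_left_def whisker_right_def)
qed

text \<open>The definition precomposes with the automorphism of
  \<open>F (g1 \<otimes> g2 \<otimes> g3)\<close> given by \<open>s\<close>. This is scaling at the
  source, so \<open>scale_eq_right\<close> turns the defining equation into one between scaled
  arrows.\<close>

lemma kappa_value_iff: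
  assumes \<alpha>: "connecting C Y P G F \<alpha>" and g: "g1 \<in> carrier G" "g2 \<in> carrier G" "g3 \<in> carrier G"
  shows "kappa_value C X A Y P b G F \<alpha> g1 g2 g3 = s \<longleftrightarrow>
    s \<in> carrier (Sec A X) \<and> (\<forall>x \<in> Obj Y.
      s \<bullet> (\<alpha> g1 g2 (FObj (F g3) x) \<odot> \<alpha> (g1 \<otimes> g2) g3 x)
        = FArr (F g1) (\<alpha> g2 g3 x) \<odot> \<alpha> g1 (g2 \<otimes> g3) x)"
    (is "_ \<longleftrightarrow> ?Q s")
proof -
  have "\<alpha> g1 g2 (FObj (F g3) x) \<odot> \<alpha> (g1 \<otimes> g2) g3 x
      \<odot> section_aut C X A P b (F (g1 \<otimes> g2 \<otimes> g3)) s x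
    = s \<bullet> (\<alpha> g1 g2 (FObj (F g3) x) \<odot> \<alpha> (g1 \<otimes> g2) g3 x)"
    if x: "x \<in> Obj Y" and s: "s \<in> carrier (Sec A X)" for x s
  proof -
    have "\<alpha> g1 g2 (FObj (F g3) x) \<odot> \<alpha> (g1 \<otimes> g2) g3 x \<in>
        Hom Y (FObj (F (g1 \<otimes> g2 \<otimes> g3)) x) (FObj (F g1) (FObj (F g2) (FObj (F g3) x)))"
      using Y.Cmp_Hom[OF connecting_Hom[OF \<alpha> g(1,2) endo_Obj[OF F_endo[OF g(3)] x]]
          connecting_Hom[OF \<alpha> _ g(3) x, of "g1 \<otimes> g2"]] g by simp
    from scale_eq_right[OF this s] show ?thesis
      using endo_FObj[OF F_endo x, of "g1 \<otimes> g2 \<otimes> g3"] g by (simp add: section_aut_def global_res_def)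
  qed
  then have eq: "kappa_value C X A Y P b G F \<alpha> g1 g2 g3 = (THE s. ?Q s)"
    unfolding kappa_value_def vcomp_def whisker_left_def whisker_right_def
    by (intro arg_cong[where f = The] ext) auto
  show ?thesis unfolding eq using ex1_kappa_value[OF \<alpha> g] by (rule the_eq_iff)
qed

lemmas kappa_value_closed = kappa_value_iff[THEN iffD1, OF _ _ _ _ refl, THEN conjunct1]
  and kappa_value_eq = kappa_value_iff[THEN iffD1, OF _ _ _ _ refl, THEN conjunct2, rule_format]

lemma kappa_Cons:
  "\<lbrakk>g1 \<in> carrier G; g2 \<in> carrier G; g3 \<in> carrier G\<rbrakk>
    \<Longrightarrow> kappa C X A Y P b G F \<alpha> [g1, g2, g3] = kappa_value C X A Y P b G F \<alpha> g1 g2 g3"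
  by (simp add: kappa_def tuples_def)

lemma kappa_cochain:
  assumes \<alpha>: "connecting C Y P G F \<alpha>"
  shows "kappa C X A Y P b G F \<alpha> \<in> carrier (cochain_group G (Sec A X) 3)"
proof -
  have "kappa C X A Y P b G F \<alpha> gs \<in> carrier (Sec A X)" if gs3: "gs \<in> tuples G 3" for gs
    by (rule tuples_3E[OF gs3]) (simp add: kappa_Cons kappa_value_closed[OF \<alpha>])
  then show ?thesis by (auto simp: cochain_group_def kappa_def)
qed

text \<open>The pentagon runs from the value at \<open>x\<close> of the endomorphism for the
  fourfold product to the fourfold composite applied to \<open>x\<close>. Its scaled faces are the
  defining equations of \<kappa>: for \<open>g1\<close>, \<open>g2\<close>, \<open>g3\<close> it is
  taken at \<open>FObj (F g4) x\<close>, for \<open>g2\<close>, \<open>g3\<close>, \<open>g4\<close>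
  it is transported by \<open>F g1\<close>, and the other three are taken at \<open>x\<close>. The
  remaining face is naturality of \<open>\<alpha> g1 g2\<close> at the arrow
  \<open>\<alpha> g3 g4 x\<close>.\<close>

lemma kappa_value_cocycle:
  assumes \<alpha>: "connecting C Y P G F \<alpha>"
    and g: "g1 \<in> carrier G" "g2 \<in> carrier G" "g3 \<in> carrier G" "g4 \<in> carrier G"
  defines "\<kappa> \<equiv> kappa_value C X A Y P b G F \<alpha>"
  shows "act g1 (\<kappa> g2 g3 g4) \<otimes>\<^bsub>Sec A X\<^esub> (\<kappa> g1 (g2 \<otimes> g3) g4 \<otimes>\<^bsub>Sec A X\<^esub> \<kappa> g1 g2 g3)
    = \<kappa> g1 g2 (g3 \<otimes> g4) \<otimes>\<^bsub>Sec A X\<^esub> \<kappa> (g1 \<otimes> g2) g3 g4"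
proof -
  note E = F_endo[OF g(1)] F_endo[OF g(2)] F_endo[OF g(3)] F_endo[OF g(4)]
  have g': "g1 \<otimes> g2 \<in> carrier G" "g2 \<otimes> g3 \<in> carrier G" "g3 \<otimes> g4 \<in> carrier G"
    "g1 \<otimes> (g2 \<otimes> g3) \<in> carrier G" "g2 \<otimes> (g3 \<otimes> g4) \<in> carrier G" using g by auto
  note H = connecting_Hom[OF \<alpha>] and K = kappa_value_eq[OF \<alpha>] and Kc = kappa_value_closed[OF \<alpha>]
  show ?thesis
  proof (rule scale_eqI)
    show "gerbe_endo Y P (F (g1 \<otimes> (g2 \<otimes> (g3 \<otimes> g4))))" using F_endo g by simp
    show "act g1 (\<kappa> g2 g3 g4) \<otimes>\<^bsub>Sec A X\<^esub> (\<kappa> g1 (g2 \<otimes> g3) g4 \<otimes>\<^bsub>Sec A X\<^esub> \<kappa> g1 g2 g3) \<in> carrier (Sec A X)"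
      "\<kappa> g1 g2 (g3 \<otimes> g4) \<otimes>\<^bsub>Sec A X\<^esub> \<kappa> (g1 \<otimes> g2) g3 g4 \<in> carrier (Sec A X)"
      using g g' Kc act_closed by (auto simp: \<kappa>_def)
    fix x assume x: "x \<in> Obj Y"
    have x': "FObj (F g4) x \<in> Obj Y" "FObj (F g3) (FObj (F g4) x) \<in> Obj Y" "FObj (F (g3 \<otimes> g4)) x \<in> Obj Y"
      using x endo_Obj F_endo g g' by auto
    let ?p = "\<alpha> g1 g2 (FObj (F g3) (FObj (F g4) x))" and ?q = "\<alpha> (g1 \<otimes> g2) g3 (FObj (F g4) x)"
      and ?r = "\<alpha> (g1 \<otimes> (g2 \<otimes> g3)) g4 x" and ?u = "FArr (F g1) (\<alpha> g2 g3 (FObj (F g4) x))"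
      and ?v = "\<alpha> g1 (g2 \<otimes> g3) (FObj (F g4) x)" and ?w = "FArr (F g1) (\<alpha> (g2 \<otimes> g3) g4 x)"
      and ?z = "\<alpha> g1 (g2 \<otimes> (g3 \<otimes> g4)) x" and ?t = "FArr (F g1) (FArr (F g2) (\<alpha> g3 g4 x))"
      and ?o = "FArr (F g1) (\<alpha> g2 (g3 \<otimes> g4) x)" and ?n = "FArr (F (g1 \<otimes> g2)) (\<alpha> g3 g4 x)"
      and ?m = "\<alpha> (g1 \<otimes> g2) (g3 \<otimes> g4) x" and ?l = "\<alpha> g1 g2 (FObj (F (g3 \<otimes> g4)) x)"
    \<comment> \<open>Products in \<open>G\<close> are rebracketed to the right so that consecutive
      arrows have syntactically equal endpoints.\<close>
    note Hp = H[OF g(1,2) x'(2)]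
      and Hq = H[OF g'(1) g(3) x'(1), unfolded m_assoc[OF g(1-3)]]
      and Hr = H[OF g'(4) g(4) x, unfolded m_assoc[OF g(1) g'(2) g(4)] m_assoc[OF g(2-4)]]
      and Hu = endo_Hom[OF E(1) H[OF g(2,3) x'(1)]]
      and Hv = H[OF g(1) g'(2) x'(1)]
      and Hw = endo_Hom[OF E(1) H[OF g'(2) g(4) x, unfolded m_assoc[OF g(2-4)]]]
      and Hz = H[OF g(1) g'(5) x]
      and Ht = endo_Hom[OF E(1) endo_Hom[OF E(2) H[OF g(3,4) x]]]
      and Ho = endo_Hom[OF E(1) H[OF g(2) g'(3) x]]
      and Hn = endo_Hom[OF F_endo[OF g'(1)] H[OF g(3,4) x]]
      and Hm = H[OF g'(1,3) x, unfolded m_assoc[OF g(1,2) g'(3)]]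
      and Hl = H[OF g(1,2) x'(3)]
    \<comment> \<open>The associativity equation for \<open>g2\<close>, \<open>g3\<close>,
      \<open>g4\<close> after applying \<open>F g1\<close>; \<open>FArr_scale\<close> turns its
      scalar into the acted one.\<close>
    have e3: "act g1 (\<kappa> g2 g3 g4) \<bullet> (?u \<odot> ?w) = ?t \<odot> ?o"
    proof -
      note h = H[OF g(2,3) x'(1)] H[OF g'(2) g(4) x, unfolded m_assoc[OF g(2-4)]]
      have "FArr (F g1) (\<kappa> g2 g3 g4 \<bullet> (\<alpha> g2 g3 (FObj (F g4) x) \<odot> \<alpha> (g2 \<otimes> g3) g4 x))
        = FArr (F g1) (FArr (F g2) (\<alpha> g3 g4 x) \<odot> \<alpha> g2 (g3 \<otimes> g4) x)"
        using K[OF g(2-4) x] by (simp add: \<kappa>_def)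
      then show ?thesis
        using FArr_scale[OF E(1) Y.Cmp_Hom[OF h] Kc[OF g(2-4)]] endo_Cmp[OF E(1) h(2,1)]
          endo_Cmp[OF E(1) H[OF g(2) g'(3) x] endo_Hom[OF E(2) H[OF g(3,4) x]]]
        by (simp add: underlying_action_def \<kappa>_def)
    qed
    have e5: "?p \<odot> ?n = ?t \<odot> ?l"
      using two_morphism_natural[OF connecting_two_morphism[OF \<alpha> g(1,2)] H[OF g(3,4) x]] by simp
    show "?p \<odot> (?q \<odot> ?r) \<in> Hom Y (FObj (F (g1 \<otimes> (g2 \<otimes> (g3 \<otimes> g4)))) x)
        (FObj (F g1) (FObj (F g2) (FObj (F g3) (FObj (F g4) x))))"
      using Y.Cmp_Hom[OF Hp Y.Cmp_Hom[OF Hq Hr]] .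
    show "(act g1 (\<kappa> g2 g3 g4) \<otimes>\<^bsub>Sec A X\<^esub> (\<kappa> g1 (g2 \<otimes> g3) g4 \<otimes>\<^bsub>Sec A X\<^esub> \<kappa> g1 g2 g3)) \<bullet> (?p \<odot> (?q \<odot> ?r))
      = (\<kappa> g1 g2 (g3 \<otimes> g4) \<otimes>\<^bsub>Sec A X\<^esub> \<kappa> (g1 \<otimes> g2) g3 g4) \<bullet> (?p \<odot> (?q \<odot> ?r))"
      unfolding \<kappa>_def
    proof (rule scalar_pentagon[OF Hp Hq Hr Hu Hv Hw Hz Ht Ho Hn Hm Hl _ _ _ _ _ _ _ e3[unfolded \<kappa>_def] _ e5])
      show "kappa_value C X A Y P b G F \<alpha> g1 g2 g3 \<bullet> (?p \<odot> ?q) = ?u \<odot> ?v"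
        using K[OF g(1-3) x'(1)] .
      show "kappa_value C X A Y P b G F \<alpha> g1 (g2 \<otimes> g3) g4 \<bullet> (?v \<odot> ?r) = ?w \<odot> ?z"
        using K[OF g(1) g'(2) g(4) x] m_assoc[OF g(2-4)] by simp
      show "kappa_value C X A Y P b G F \<alpha> (g1 \<otimes> g2) g3 g4 \<bullet> (?q \<odot> ?r) = ?n \<odot> ?m"
        using K[OF g'(1) g(3,4) x] m_assoc[OF g(1-3)] by simp
      show "kappa_value C X A Y P b G F \<alpha> g1 g2 (g3 \<otimes> g4) \<bullet> (?l \<odot> ?m) = ?o \<odot> ?z"
        using K[OF g(1,2) g'(3) x] .
    qed (use g g' Kc act_closed in auto)
  qed
qed

lemma kappa_cocycle:
  assumes \<alpha>: "connecting C Y P G F \<alpha>"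
  shows "kappa C X A Y P b G F \<alpha> \<in> cocycles G (Sec A X) act 3"
proof -
  let ?\<kappa> = "kappa C X A Y P b G F \<alpha>"
  have 4: "tuples G (Suc 3) = tuples G 4" by simp
  have "differential G (Sec A X) act 3 ?\<kappa> gs = \<one>\<^bsub>Sec A X\<^esub>" if gs4: "gs \<in> tuples G 4" for gs
  proof -
    obtain g h k l where gs: "gs = [g, h, k, l]"
      and c: "g \<in> carrier G" "h \<in> carrier G" "k \<in> carrier G" "l \<in> carrier G"
      by (rule tuples_4E[OF gs4])
    note kc = kappa_value_closed[OF \<alpha>]
    define a where "a = act g (kappa_value C X A Y P b G F \<alpha> h k l)"
    define p where "p = kappa_value C X A Y P b G F \<alpha> (g \<otimes> h) k l"
    define q where "q = kappa_value C X A Y P b G F \<alpha> g (h \<otimes> k) l"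
    define r where "r = kappa_value C X A Y P b G F \<alpha> g h (k \<otimes> l)"
    define s where "s = kappa_value C X A Y P b G F \<alpha> g h k"
    have m: "a \<in> carrier (Sec A X)" "p \<in> carrier (Sec A X)" "q \<in> carrier (Sec A X)"
      "r \<in> carrier (Sec A X)" "s \<in> carrier (Sec A X)"
      using kc c act_closed by (auto simp: a_def p_def q_def r_def s_def)
    have "differential G (Sec A X) act 3 ?\<kappa> gs
      = a \<otimes>\<^bsub>Sec A X\<^esub> (inv\<^bsub>Sec A X\<^esub> p \<otimes>\<^bsub>Sec A X\<^esub> q \<otimes>\<^bsub>Sec A X\<^esub> inv\<^bsub>Sec A X\<^esub> r) \<otimes>\<^bsub>Sec A X\<^esub> s"
      using differential_3[OF kappa_cochain[OF \<alpha>] c] c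
      by (simp add: gs kappa_Cons a_def p_def q_def r_def s_def)
    \<comment> \<open>Collects the factors with exponent +1 against those with exponent -1, so that
      the inverse-free pentagon identity applies.\<close>
    also have "\<dots> = (a \<otimes>\<^bsub>Sec A X\<^esub> (q \<otimes>\<^bsub>Sec A X\<^esub> s)) \<otimes>\<^bsub>Sec A X\<^esub> inv\<^bsub>Sec A X\<^esub> (r \<otimes>\<^bsub>Sec A X\<^esub> p)"
      using m by (simp add: M.inv_mult M.m_ac)
    also have "a \<otimes>\<^bsub>Sec A X\<^esub> (q \<otimes>\<^bsub>Sec A X\<^esub> s) = r \<otimes>\<^bsub>Sec A X\<^esub> p"
      using kappa_value_cocycle[OF \<alpha> c] by (simp add: a_def p_def q_def r_def s_def)
    finally show ?thesis using m by simp
  qed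
  then show ?thesis
    using kappa_cochain[OF \<alpha>] by (auto simp: cocycles_def cochain_group_def differential_def 4)
qed

text \<open>Both composites for \<beta> are the composites for \<alpha> scaled by two values of
  \<open>c\<close> each, one of them twisted by \<open>act g1\<close> because it passes through
  \<open>F g1\<close>. Comparing the two defining equations on the same arrow gives this
  inverse-free form of the coboundary relation.\<close>

lemma kappa_value_change:
  assumes \<alpha>: "connecting C Y P G F \<alpha>" and \<beta>: "connecting C Y P G F \<beta>"
    and c: "\<And>g h. \<lbrakk>g \<in> carrier G; h \<in> carrier G\<rbrakk> \<Longrightarrow> c g h \<in> carrier (Sec A X)"
    and c\<alpha>: "\<And>g h x. \<lbrakk>g \<in> carrier G; h \<in> carrier G; x \<in> Obj Y\<rbrakk> \<Longrightarrow> c g h \<bullet> \<alpha> g h x = \<beta> g h x"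
    and g: "g1 \<in> carrier G" "g2 \<in> carrier G" "g3 \<in> carrier G"
  shows "kappa_value C X A Y P b G F \<beta> g1 g2 g3 \<otimes>\<^bsub>Sec A X\<^esub> (c g1 g2 \<otimes>\<^bsub>Sec A X\<^esub> c (g1 \<otimes> g2) g3)
    = act g1 (c g2 g3) \<otimes>\<^bsub>Sec A X\<^esub> c g1 (g2 \<otimes> g3) \<otimes>\<^bsub>Sec A X\<^esub> kappa_value C X A Y P b G F \<alpha> g1 g2 g3"
proof -
  note E = F_endo[OF g(1)] F_endo[OF g(2)] F_endo[OF g(3)]
  have g': "g1 \<otimes> g2 \<in> carrier G" "g2 \<otimes> g3 \<in> carrier G" using g by auto
  note H = connecting_Hom[OF \<alpha>] and Kc = kappa_value_closed[OF \<alpha> g] kappa_value_closed[OF \<beta> g]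
  note cc = c[OF g(1,2)] c[OF g'(1) g(3)] act_closed[OF g(1) c[OF g(2,3)]] c[OF g(1) g'(2)]
  show ?thesis
  proof (rule scale_eqI)
    show "gerbe_endo Y P (F (g1 \<otimes> (g2 \<otimes> g3)))" using F_endo g by simp
    fix x assume x: "x \<in> Obj Y"
    have x': "FObj (F g3) x \<in> Obj Y" using x endo_Obj E by auto
    let ?p = "\<alpha> g1 g2 (FObj (F g3) x)" and ?q = "\<alpha> (g1 \<otimes> g2) g3 x"
      and ?u = "FArr (F g1) (\<alpha> g2 g3 x)" and ?v = "\<alpha> g1 (g2 \<otimes> g3) x"
    note Hp = H[OF g(1,2) x'] and Hq = H[OF g'(1) g(3) x, unfolded m_assoc[OF g]]
      and Hu = endo_Hom[OF E(1) H[OF g(2,3) x]] and Hv = H[OF g(1) g'(2) x]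
    note Hpq = Y.Cmp_Hom[OF Hp Hq] and Huv = Y.Cmp_Hom[OF Hu Hv]
    show "?p \<odot> ?q \<in> Hom Y (FObj (F (g1 \<otimes> (g2 \<otimes> g3))) x) (FObj (F g1) (FObj (F g2) (FObj (F g3) x)))"
      using Hpq .
    have "(c g1 g2 \<bullet> ?p) \<odot> (c (g1 \<otimes> g2) g3 \<bullet> ?q)
      = (c g1 g2 \<otimes>\<^bsub>Sec A X\<^esub> c (g1 \<otimes> g2) g3) \<bullet> (?p \<odot> ?q)"
      using scale_Cmp_left[OF Hp scale_Hom[OF Hq cc(2)] cc(1)] scale_Cmp_right[OF Hp Hq cc(2)]
        scale_mult[OF Hpq cc(1,2)] by simp
    then have "(kappa_value C X A Y P b G F \<beta> g1 g2 g3 \<otimes>\<^bsub>Sec A X\<^esub>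
        (c g1 g2 \<otimes>\<^bsub>Sec A X\<^esub> c (g1 \<otimes> g2) g3)) \<bullet> (?p \<odot> ?q)
      = FArr (F g1) (\<beta> g2 g3 x) \<odot> \<beta> g1 (g2 \<otimes> g3) x"
      using kappa_value_eq[OF \<beta> g x] scale_mult[OF Hpq Kc(2), of "c g1 g2 \<otimes>\<^bsub>Sec A X\<^esub> c (g1 \<otimes> g2) g3"]
        c\<alpha>[OF g(1,2) x'] c\<alpha>[OF g'(1) g(3) x] cc by simp
    also have "\<dots> = (act g1 (c g2 g3) \<bullet> ?u) \<odot> (c g1 (g2 \<otimes> g3) \<bullet> ?v)"
      using FArr_scale[OF E(1) H[OF g(2,3) x] c[OF g(2,3)]] c\<alpha>[OF g(2,3) x] c\<alpha>[OF g(1) g'(2) x]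
      by (simp add: underlying_action_def)
    also have "\<dots> = (act g1 (c g2 g3) \<otimes>\<^bsub>Sec A X\<^esub> c g1 (g2 \<otimes> g3)) \<bullet> (?u \<odot> ?v)"
      using scale_Cmp_left[OF Hu scale_Hom[OF Hv cc(4)] cc(3)] scale_Cmp_right[OF Hu Hv cc(4)]
        scale_mult[OF Huv cc(3,4)] by simp
    also have "?u \<odot> ?v = kappa_value C X A Y P b G F \<alpha> g1 g2 g3 \<bullet> (?p \<odot> ?q)"
      using kappa_value_eq[OF \<alpha> g x] by simp
    finally show "(kappa_value C X A Y P b G F \<beta> g1 g2 g3 \<otimes>\<^bsub>Sec A X\<^esub>
        (c g1 g2 \<otimes>\<^bsub>Sec A X\<^esub> c (g1 \<otimes> g2) g3)) \<bullet> (?p \<odot> ?q)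
      = (act g1 (c g2 g3) \<otimes>\<^bsub>Sec A X\<^esub> c g1 (g2 \<otimes> g3) \<otimes>\<^bsub>Sec A X\<^esub>
          kappa_value C X A Y P b G F \<alpha> g1 g2 g3) \<bullet> (?p \<odot> ?q)"
      using scale_mult[OF Hpq M.m_closed[OF cc(3,4)] Kc(1)] by simp
  qed (use cc Kc in auto)
qed

lemma kappa_class_independent:
  assumes \<alpha>: "connecting C Y P G F \<alpha>" and \<beta>: "connecting C Y P G F \<beta>"
  shows "cohomology_class G (Sec A X) act 3 (kappa C X A Y P b G F \<beta>)
    = cohomology_class G (Sec A X) act 3 (kappa C X A Y P b G F \<alpha>)"
proof -
  have "\<exists>s. s \<in> carrier (Sec A X) \<and> (\<forall>x \<in> Obj Y. s \<bullet> \<alpha> g h x = \<beta> g h x)"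
    if g: "g \<in> carrier G" "h \<in> carrier G" for g h
    using ex1_scale_two_morphism[OF F_endo[OF m_closed[OF g]] gerbe_endo_comp[OF F_endo[OF g(1)] F_endo[OF g(2)]]
        connecting_two_morphism[OF \<alpha> g] connecting_two_morphism[OF \<beta> g]] by (rule ex1_implies_ex)
  \<comment> \<open>The torsor property applied to each pair of group elements yields the 2-cochain
    of differences between \<alpha> and \<beta>.\<close>
  then obtain c where c: "\<And>g h. \<lbrakk>g \<in> carrier G; h \<in> carrier G\<rbrakk> \<Longrightarrow> c g h \<in> carrier (Sec A X)"
    and c\<alpha>: "\<And>g h x. \<lbrakk>g \<in> carrier G; h \<in> carrier G; x \<in> Obj Y\<rbrakk> \<Longrightarrow> c g h \<bullet> \<alpha> g h x = \<beta> g h x"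
    by metis
  \<comment> \<open>The same cochain as an extensional function on tuples, as required by
    \<open>cochain_group\<close>.\<close>
  define d where "d = (\<lambda>gs \<in> tuples G 2. c (gs ! 0) (gs ! 1))"
  have d2: "d [g, h] = c g h" if "g \<in> carrier G" "h \<in> carrier G" for g h
    using that by (simp add: d_def tuples_def)
  have d: "d \<in> carrier (cochain_group G (Sec A X) 2)"
    by (auto simp: d_def cochain_group_def tuples_def numeral_2_eq_2 length_Suc_conv intro!: c)
  let ?\<kappa> = "kappa C X A Y P b G F" and ?\<delta> = "differential G (Sec A X) act 2 d"
  have eq: "?\<kappa> \<beta> gs = ?\<delta> gs \<otimes>\<^bsub>Sec A X\<^esub> ?\<kappa> \<alpha> gs" if gs3: "gs \<in> tuples G 3" for gs
  proof -
    obtain g h k where gs: "gs = [g, h, k]" and g: "g \<in> carrier G" "h \<in> carrier G" "k \<in> carrier G"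
      by (rule tuples_3E[OF gs3])
    define a where "a = act g (c h k)"
    define p where "p = c (g \<otimes> h) k"
    define q where "q = c g (h \<otimes> k)"
    define r where "r = c g h"
    define s where "s = ?\<kappa> \<alpha> gs"
    define s' where "s' = ?\<kappa> \<beta> gs"
    have m: "a \<in> carrier (Sec A X)" "p \<in> carrier (Sec A X)" "q \<in> carrier (Sec A X)"
      "r \<in> carrier (Sec A X)" "s \<in> carrier (Sec A X)" "s' \<in> carrier (Sec A X)"
      using c act_closed g kappa_value_closed[OF \<alpha> g] kappa_value_closed[OF \<beta> g]
      by (auto simp: a_def p_def q_def r_def s_def s'_def gs kappa_Cons)
    \<comment> \<open>Multiplying and dividing by \<open>r\<close> and \<open>p\<close> prepares the
      use of \<open>kappa_value_change\<close>; their inverses then become the negative factors of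
      the differential.\<close>
    have "s' = s' \<otimes>\<^bsub>Sec A X\<^esub> (r \<otimes>\<^bsub>Sec A X\<^esub> p) \<otimes>\<^bsub>Sec A X\<^esub> inv\<^bsub>Sec A X\<^esub> (r \<otimes>\<^bsub>Sec A X\<^esub> p)"
      using m by (simp add: M.m_assoc)
    also have "s' \<otimes>\<^bsub>Sec A X\<^esub> (r \<otimes>\<^bsub>Sec A X\<^esub> p) = a \<otimes>\<^bsub>Sec A X\<^esub> q \<otimes>\<^bsub>Sec A X\<^esub> s"
      using kappa_value_change[OF \<alpha> \<beta> c c\<alpha> g] g
      by (simp add: a_def p_def q_def r_def s_def s'_def gs kappa_Cons)
    also have "\<dots> \<otimes>\<^bsub>Sec A X\<^esub> inv\<^bsub>Sec A X\<^esub> (r \<otimes>\<^bsub>Sec A X\<^esub> p)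
      = a \<otimes>\<^bsub>Sec A X\<^esub> (inv\<^bsub>Sec A X\<^esub> p \<otimes>\<^bsub>Sec A X\<^esub> q) \<otimes>\<^bsub>Sec A X\<^esub> inv\<^bsub>Sec A X\<^esub> r \<otimes>\<^bsub>Sec A X\<^esub> s"
      using m by (simp add: M.inv_mult M.m_ac)
    also have "\<dots> = ?\<delta> gs \<otimes>\<^bsub>Sec A X\<^esub> s"
      using differential_2[OF d g] g by (simp add: gs d2 a_def p_def q_def r_def)
    finally show ?thesis by (simp add: s_def s'_def)
  qed
  have "?\<kappa> \<beta> = ?\<delta> \<otimes>\<^bsub>cochain_group G (Sec A X) 3\<^esub> ?\<kappa> \<alpha>"
  proof
    \<comment> \<open>Outside \<open>tuples G 3\<close> both sides are restricted functions with the
      same default value.\<close>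
    fix gs show "?\<kappa> \<beta> gs = (?\<delta> \<otimes>\<^bsub>cochain_group G (Sec A X) 3\<^esub> ?\<kappa> \<alpha>) gs"
      using eq[of gs] by (cases "gs \<in> tuples G 3") (simp_all add: cochain_group_def kappa_def)
  qed
  moreover have "?\<delta> \<in> coboundaries G (Sec A X) act 3"
    using d by (simp add: numeral_3_eq_3 numeral_2_eq_2)
  ultimately show ?thesis using cohomology_class_coboundary kappa_cochain[OF \<alpha>] by simp
qed

end

theorem proposition4p23:
  fixes C :: "('o, 'm) category" and J :: "'o \<Rightarrow> 'm set set" and X :: 'o
    and A :: "('o, 'm, 'a) presheaf"
    and Y :: "('p, 'q) category" and P :: "('p, 'q, 'o, 'm) functor_data"
    and b :: "'p \<Rightarrow> 'a \<Rightarrow> 'q"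
    and G :: "'g monoid"
    and F :: "'g \<Rightarrow> ('p, 'q) endo" and \<alpha> :: "'g \<Rightarrow> 'g \<Rightarrow> 'p \<Rightarrow> 'q"
  assumes "site C J"
    and "final_object C X"
    and "abelian_sheaf C J A"
    and "group G" and "finite (carrier G)"
    and "banded_gerbe C J A Y P b"
    and "gerbe_action C A Y P b G F"
    and "connecting C Y P G F \<alpha>"
  shows "let M = Sec A X; act = underlying_action C X A Y P b F; \<kappa> = kappa C X A Y P b G F in
     is_G_module G M act \<and>
     \<kappa> \<alpha> \<in> cocycles G M act 3 \<and>
     cohomology_class G M act 3 (\<kappa> \<alpha>) \<in> carrier (cohomology G M act 3) \<and>
     (\<forall>\<alpha>'. connecting C Y P G F \<alpha>' \<longrightarrow>
        cohomology_class G M act 3 (\<kappa> \<alpha>') = cohomology_class G M act 3 (\<kappa> \<alpha>))"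
proof -
  interpret gerbe_with_action C J A Y P b X G F
    using assms by (simp add: gerbe_with_action_def gerbe_with_action_axioms_def
        banded_gerbe_final_def banded_gerbe_final_axioms_def)
  show ?thesis
    unfolding Let_def
    using assms(8) G_module_sections kappa_cocycle cohomology_class_in_cohomology kappa_class_independent
    by blast
qed

end
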